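(* Let $M^m$ be a compact Kähler manifold with $Ric^{\perp}<0$. Then there does not exist any nonzero holomorphic vector field on $M$.
   Context: $M^m$ is a Kähler manifold of complex dimension $m$ with almost complex structure $C$; the curvature tensor $R$ has the sign convention that $R(X,Y,Y,X)$ is the sectional curvature for orthonormal $X,Y$. The orthogonal Ricci curvature of a nonzero real vector $X$ is $Ric^{\perp}(X,X)=Ric(X,X)-\frac{1}{|X|^2}R(X,C(X),C(X),X)$; $Ric^\perp<0$ means $Ric^\perp(X,X)<0$ for all real $X\ne0$ at every point. Equivalently, for every unitary frame $\{E_i\}$ of $T'M$, $\sum_{j=2}^mR(E_1,\overline E_1,E_j,\overline E_j)<0$. *)

theory Defs
  imports "HOL-Analysis.Analysis"
begin

section \<open>Calculus on open subsets of Euclidean spaces\<close>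

abbreviation dir_deriv ::
  "('e::real_normed_vector \<Rightarrow> 'f::real_normed_vector) \<Rightarrow> 'e \<Rightarrow> 'e \<Rightarrow> 'f" where
  "dir_deriv f x u \<equiv> frechet_derivative f (at x) u"

text \<open>The predicates \<open>Ck_on\<close>, \<open>smooth_on\<close> and \<open>holomorphic_map_on\<close> are meant for open sets.\<close>

primrec Ck_on ::
  "nat \<Rightarrow> 'e::real_normed_vector set \<Rightarrow> ('e \<Rightarrow> 'f::real_normed_vector) \<Rightarrow> bool" where
  "Ck_on 0 S f \<longleftrightarrow> continuous_on S f"
| "Ck_on (Suc k) S f \<longleftrightarrow>
     (\<forall>x\<in>S. f differentiable (at x)) \<and> (\<forall>u. Ck_on k S (\<lambda>x. dir_deriv f x u))"

definition smooth_on ::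
  "'e::real_normed_vector set \<Rightarrow> ('e \<Rightarrow> 'f::real_normed_vector) \<Rightarrow> bool" where
  "smooth_on S f \<longleftrightarrow> (\<forall>k. Ck_on k S f)"

text \<open>Several complex variables: differentiable at every point with complex-linear derivative.\<close>

definition holomorphic_map_on ::
  "(complex^'m::finite \<Rightarrow> complex^'n::finite) \<Rightarrow> (complex^'m) set \<Rightarrow> bool" where
  "holomorphic_map_on f S \<longleftrightarrow>
     (\<forall>x\<in>S. \<exists>f'. (f has_derivative f') (at x) \<and> (\<forall>a u. f' (a *s u) = a *s f' u))"

section \<open>Riemannian geometry in a coordinate domain\<close>

text \<open>
  Here \<open>h x u v\<close> is a field of inner products on an open subset of a Euclidean space, and vectors
  \<open>u\<close>, \<open>v\<close>, \<open>w\<close> stand for the corresponding constant (coordinate) vector fields, so that all Lie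
  brackets vanish. The vector \<open>christoffel h x u v\<close> is the covariant derivative of \<open>v\<close> along
  \<open>u\<close> for the Levi-Civita connection, determined by the Koszul formula.
\<close>

definition christoffel ::
  "('e::euclidean_space \<Rightarrow> 'e \<Rightarrow> 'e \<Rightarrow> real) \<Rightarrow> 'e \<Rightarrow> 'e \<Rightarrow> 'e \<Rightarrow> 'e" where
  "christoffel h x u v =
     (THE w. \<forall>z. 2 * h x w z =
        dir_deriv (\<lambda>y. h y v z) x u + dir_deriv (\<lambda>y. h y u z) x v - dir_deriv (\<lambda>y. h y u v) x z)"

text \<open>\<open>R(u,v)w = \<nabla>\<^sub>u\<nabla>\<^sub>v w - \<nabla>\<^sub>v\<nabla>\<^sub>u w\<close>\<close>

definition curvature_op ::
  "('e::euclidean_space \<Rightarrow> 'e \<Rightarrow> 'e \<Rightarrow> real) \<Rightarrow> 'e \<Rightarrow> 'e \<Rightarrow> 'e \<Rightarrow> 'e \<Rightarrow> 'e" where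
  "curvature_op h x u v w =
     (dir_deriv (\<lambda>y. christoffel h y v w) x u + christoffel h x u (christoffel h x v w))
   - (dir_deriv (\<lambda>y. christoffel h y u w) x v + christoffel h x v (christoffel h x u w))"

section \<open>Complex manifolds\<close>

text \<open>
  A chart is a pair of its domain and its coordinate map. The dimension is \<open>CARD('m)\<close>.
\<close>

type_synonym ('a, 'm) chart = "'a set \<times> ('a \<Rightarrow> complex^'m)"

abbreviation chart_dom :: "('a, 'm::finite) chart \<Rightarrow> 'a set" where
  "chart_dom \<equiv> fst"

abbreviation chart_map :: "('a, 'm::finite) chart \<Rightarrow> 'a \<Rightarrow> complex^'m" where
  "chart_map \<equiv> snd"

abbreviation chart_image :: "('a, 'm::finite) chart \<Rightarrow> (complex^'m) set" where
  "chart_image c \<equiv> chart_map c ` chart_dom c"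

abbreviation chart_inv :: "('a, 'm::finite) chart \<Rightarrow> complex^'m \<Rightarrow> 'a" where
  "chart_inv c \<equiv> inv_into (chart_dom c) (chart_map c)"

definition transition ::
  "('a, 'm::finite) chart \<Rightarrow> ('a, 'm) chart \<Rightarrow> complex^'m \<Rightarrow> complex^'m" where
  "transition c d = chart_map d \<circ> chart_inv c"

definition complex_manifold :: "'a topology \<Rightarrow> ('a, 'm::finite) chart set \<Rightarrow> bool" where
  "complex_manifold M A \<longleftrightarrow>
     Hausdorff_space M \<and> second_countable M \<and>
     (\<Union>c\<in>A. chart_dom c) = topspace M \<and>
     (\<forall>c\<in>A. openin M (chart_dom c) \<and> open (chart_image c) \<and>
        homeomorphic_map (subtopology M (chart_dom c)) (top_of_set (chart_image c)) (chart_map c)) \<and>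
     (\<forall>c\<in>A. \<forall>d\<in>A.
        holomorphic_map_on (transition c d) (chart_map c ` (chart_dom c \<inter> chart_dom d)))"

section \<open>Tangent vectors and vector fields\<close>

text \<open>
  A tangent vector at \<open>p\<close> assigns to each chart around \<open>p\<close> its coordinates in that chart, subject
  to the transformation law under coordinate changes (and is \<open>0\<close> at all other arguments, to make
  the representation unique). The real tangent space is thereby identified with the holomorphic
  tangent space \<open>T'M\<close>, the almost complex structure being multiplication of coordinates
  by \<open>\<i>\<close>.
\<close>

type_synonym ('a, 'm) tvec = "('a, 'm) chart \<Rightarrow> complex^'m"

definition tangent_space ::
  "('a, 'm::finite) chart set \<Rightarrow> 'a \<Rightarrow> ('a, 'm) tvec set" where
  "tangent_space A p =
     {X. (\<forall>c\<in>A. \<forall>d\<in>A. p \<in> chart_dom c \<and> p \<in> chart_dom d \<longrightarrow>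
            X d = dir_deriv (transition c d) (chart_map c p) (X c)) \<and>
         (\<forall>c. \<not> (c \<in> A \<and> p \<in> chart_dom c) \<longrightarrow> X c = 0)}"

definition tvec_zero :: "('a, 'm::finite) tvec" where
  "tvec_zero = (\<lambda>c. 0)"

definition tvec_add :: "('a, 'm::finite) tvec \<Rightarrow> ('a, 'm) tvec \<Rightarrow> ('a, 'm) tvec" where
  "tvec_add X Y = (\<lambda>c. X c + Y c)"

definition tvec_scale :: "real \<Rightarrow> ('a, 'm::finite) tvec \<Rightarrow> ('a, 'm) tvec" where
  "tvec_scale a X = (\<lambda>c. a *\<^sub>R X c)"

definition cpx_struct :: "('a, 'm::finite) tvec \<Rightarrow> ('a, 'm) tvec" where
  "cpx_struct X = (\<lambda>c. \<i> *s X c)"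

text \<open>The tangent vector at \<open>p\<close> whose coordinates in the chart \<open>c\<close> are \<open>u\<close>.\<close>

definition tvec_of_coords ::
  "('a, 'm::finite) chart set \<Rightarrow> ('a, 'm) chart \<Rightarrow> 'a \<Rightarrow> complex^'m \<Rightarrow> ('a, 'm) tvec" where
  "tvec_of_coords A c p u =
     (\<lambda>d. if d \<in> A \<and> p \<in> chart_dom d then dir_deriv (transition c d) (chart_map c p) u else 0)"

definition holomorphic_vector_field ::
  "'a topology \<Rightarrow> ('a, 'm::finite) chart set \<Rightarrow> ('a \<Rightarrow> ('a, 'm) tvec) \<Rightarrow> bool" where
  "holomorphic_vector_field M A V \<longleftrightarrow>
     (\<forall>p\<in>topspace M. V p \<in> tangent_space A p) \<and>
     (\<forall>c\<in>A. holomorphic_map_on (\<lambda>x. V (chart_inv c x) c) (chart_image c))"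

section \<open>Kaehler metrics\<close>

definition local_metric ::
  "('a, 'm::finite) chart set \<Rightarrow> ('a \<Rightarrow> ('a, 'm) tvec \<Rightarrow> ('a, 'm) tvec \<Rightarrow> real) \<Rightarrow>
   ('a, 'm) chart \<Rightarrow> complex^'m \<Rightarrow> complex^'m \<Rightarrow> complex^'m \<Rightarrow> real" where
  "local_metric A g c x u v =
     g (chart_inv c x) (tvec_of_coords A c (chart_inv c x) u) (tvec_of_coords A c (chart_inv c x) v)"

definition riemannian_metric ::
  "'a topology \<Rightarrow> ('a, 'm::finite) chart set \<Rightarrow>
   ('a \<Rightarrow> ('a, 'm) tvec \<Rightarrow> ('a, 'm) tvec \<Rightarrow> real) \<Rightarrow> bool" where
  "riemannian_metric M A g \<longleftrightarrow>
     (\<forall>p\<in>topspace M. \<forall>X\<in>tangent_space A p. \<forall>Y\<in>tangent_space A p. \<forall>Z\<in>tangent_space A p. \<forall>a.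
        g p (tvec_add X Y) Z = g p X Z + g p Y Z \<and>
        g p (tvec_scale a X) Z = a * g p X Z \<and>
        g p X Y = g p Y X \<and>
        (X \<noteq> tvec_zero \<longrightarrow> g p X X > 0)) \<and>
     (\<forall>c\<in>A. \<forall>u v. smooth_on (chart_image c) (\<lambda>x. local_metric A g c x u v))"

text \<open>
  The last clause says that the Kaehler form \<open>\<omega>(u,v) = g(Ju,v)\<close> is closed: it is the
  coordinate expression of \<open>d\<omega>(u,v,w) = 0\<close> for constant vector fields.
\<close>

definition kaehler_metric ::
  "'a topology \<Rightarrow> ('a, 'm::finite) chart set \<Rightarrow>
   ('a \<Rightarrow> ('a, 'm) tvec \<Rightarrow> ('a, 'm) tvec \<Rightarrow> real) \<Rightarrow> bool" where
  "kaehler_metric M A g \<longleftrightarrow>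
     riemannian_metric M A g \<and>
     (\<forall>p\<in>topspace M. \<forall>X\<in>tangent_space A p. \<forall>Y\<in>tangent_space A p.
        g p (cpx_struct X) (cpx_struct Y) = g p X Y) \<and>
     (\<forall>c\<in>A. \<forall>x\<in>chart_image c. \<forall>u v w.
        let \<omega> = (\<lambda>y s t. local_metric A g c y (\<i> *s s) t) in
          dir_deriv (\<lambda>y. \<omega> y v w) x u - dir_deriv (\<lambda>y. \<omega> y u w) x v
          + dir_deriv (\<lambda>y. \<omega> y u v) x w = 0)"

section \<open>Curvature\<close>

text \<open>
  The curvature quantities at \<open>p\<close> are evaluated in a chart \<open>c\<close> around \<open>p\<close>; being tensorial,
  their values do not depend on the choice of \<open>c\<close>. The sign convention is that
  \<open>R(X,Y,Y,X)\<close> is the sectional curvature for orthonormal \<open>X\<close>, \<open>Y\<close>.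
\<close>

definition curvature_tensor ::
  "('a, 'm::finite) chart set \<Rightarrow> ('a \<Rightarrow> ('a, 'm) tvec \<Rightarrow> ('a, 'm) tvec \<Rightarrow> real) \<Rightarrow>
   ('a, 'm) chart \<Rightarrow> 'a \<Rightarrow> ('a, 'm) tvec \<Rightarrow> ('a, 'm) tvec \<Rightarrow> ('a, 'm) tvec \<Rightarrow> ('a, 'm) tvec \<Rightarrow> real"
  where
  "curvature_tensor A g c p X Y Z W =
     local_metric A g c (chart_map c p)
       (curvature_op (local_metric A g c) (chart_map c p) (X c) (Y c) (Z c)) (W c)"

text \<open>
  \<open>Ric(X,Y)\<close> is the trace of the real endomorphism \<open>Z \<mapsto> R(Z,X)Y\<close>. \<open>Basis\<close> is the standard real
  basis of the coordinate space; it need not be orthonormal for the metric, but a trace may be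
  computed in any basis.
\<close>

definition ricci_curvature ::
  "('a, 'm::finite) chart set \<Rightarrow> ('a \<Rightarrow> ('a, 'm) tvec \<Rightarrow> ('a, 'm) tvec \<Rightarrow> real) \<Rightarrow>
   ('a, 'm) chart \<Rightarrow> 'a \<Rightarrow> ('a, 'm) tvec \<Rightarrow> ('a, 'm) tvec \<Rightarrow> real" where
  "ricci_curvature A g c p X Y =
     (\<Sum>b\<in>Basis. curvature_op (local_metric A g c) (chart_map c p) b (X c) (Y c) \<bullet> b)"

definition orth_ricci ::
  "('a, 'm::finite) chart set \<Rightarrow> ('a \<Rightarrow> ('a, 'm) tvec \<Rightarrow> ('a, 'm) tvec \<Rightarrow> real) \<Rightarrow>
   ('a, 'm) chart \<Rightarrow> 'a \<Rightarrow> ('a, 'm) tvec \<Rightarrow> real" where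
  "orth_ricci A g c p X =
     ricci_curvature A g c p X X
     - 1 / g p X X * curvature_tensor A g c p X (cpx_struct X) (cpx_struct X) X"

definition orth_ricci_negative ::
  "'a topology \<Rightarrow> ('a, 'm::finite) chart set \<Rightarrow>
   ('a \<Rightarrow> ('a, 'm) tvec \<Rightarrow> ('a, 'm) tvec \<Rightarrow> real) \<Rightarrow> bool" where
  "orth_ricci_negative M A g \<longleftrightarrow>
     (\<forall>p\<in>topspace M. \<forall>c\<in>A. p \<in> chart_dom c \<longrightarrow>
        (\<forall>X\<in>tangent_space A p. X \<noteq> tvec_zero \<longrightarrow> orth_ricci A g c p X < 0))"

end

theory Submission
  imports Defs "HOL-Complex_Analysis.Cauchy_Integral_Formula"
begin

text \<open>
  Let \<open>V\<close> be a holomorphic vector field that is not identically zero. By compactness \<open>g(V,V)\<close>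
  attains a positive maximum, at \<open>p\<close> say. For a coordinate vector \<open>v\<close> at \<open>p\<close>, the sum of the
  second derivatives of \<open>g(V,V)\<close> along the straight lines in the directions \<open>v\<close> and \<open>Jv\<close> is
  \<open>4|\<nabla>\<^sub>v V|\<^sup>2 - 2 g(R(Jv,v)V, JV)\<close>: the connection is complex linear in both arguments and \<open>V\<close> is
  holomorphic, so all other terms cancel. Hence \<open>g(R(Jv,v)V, JV) \<ge> 0\<close> at \<open>p\<close> for every \<open>v\<close>.
  On the other hand \<open>g(R(Je,e)V, JV) = g(R(e,V)V, e) + g(R(Je,V)V, Je)\<close>, and so summing over an
  orthonormal basis gives \<open>2 Ric(V,V)\<close>. The basis vectors \<open>V/|V|\<close> and \<open>JV/|V|\<close> contribute
  \<open>2 R(V,JV,JV,V)/|V|\<^sup>2\<close> and the others are nonnegative, so \<open>Ric\<^sup>\<bottom>(V,V) \<ge> 0\<close>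
  at \<open>p\<close>.

  Only the restriction of \<open>V\<close> to complex lines is differentiated twice, so that Cauchy's theorem in
  one variable provides all the regularity that is needed.
\<close>

section \<open>Calculus on open sets\<close>

text \<open>The mean value theorem in the direction \<open>u\<close> turns the second difference
  into \<open>t\<close> times an increment of \<open>dir_deriv f y u\<close>; differentiability of
  that derivative at \<open>x\<close> evaluates the increment as \<open>t * L v\<close> up to
  o(\<open>t\<close>).\<close>

lemma second_difference_quotient_tendsto:
  fixes f :: "'e::real_normed_vector \<Rightarrow> real"
  assumes U: "open U" "x \<in> U"
    and f: "\<And>y. y \<in> U \<Longrightarrow> f differentiable (at y)"
    and A: "((\<lambda>y. dir_deriv f y u) has_derivative L) (at x)"
  shows "((\<lambda>t. (f (x + t *\<^sub>R u + t *\<^sub>R v) - f (x + t *\<^sub>R u) - f (x + t *\<^sub>R v) + f x) / t\<^sup>2)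
           \<longlongrightarrow> L v) (at_right 0)"
proof (rule tendstoI)
  fix e :: real assume e: "e > 0"
  define A' where "A' y = dir_deriv f y u" for y
  \<comment> \<open>The two error terms below are bounded by multiples of
    \<open>norm u + norm v\<close> and \<open>norm u\<close>; \<open>c\<close> exceeds the sum of
    these, and \<open>+ 1\<close> keeps it positive. The factor 2 in \<open>e / (2*c)\<close> makes
    the final inequality strict.\<close>
  define c where "c = 2 * norm u + norm v + 1"
  have c: "c > 0" unfolding c_def by (smt (verit) norm_ge_zero)
  have lin: "linear L" using A has_derivative_linear by blast
  obtain d1 where d1: "d1 > 0" "\<And>y. norm (y - x) < d1 \<Longrightarrow> norm (A' y - A' x - L (y - x)) \<le> e / (2*c) * norm (y - x)"
    using A e c unfolding has_derivative_at_alt A'_def by (metis divide_pos_pos mult_pos_pos zero_less_numeral)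
  obtain d2 where d2: "d2 > 0" "ball x d2 \<subseteq> U" using U open_contains_ball by blast
  define d where "d = min d1 d2 / c"
  have d: "d > 0" using d1 d2 c by (simp add: d_def)
  have "\<bar>(f (x + t *\<^sub>R u + t *\<^sub>R v) - f (x + t *\<^sub>R u) - f (x + t *\<^sub>R v) + f x) / t\<^sup>2 - L v\<bar> < e"
    if t: "0 < t" "t < d" for t
  proof -
    have small: "norm (s *\<^sub>R u + r *\<^sub>R v) \<le> t * (norm u + norm v)" if "0 \<le> s" "s \<le> t" "0 \<le> r" "r \<le> t" for s r
      using that norm_triangle_ineq[of "s *\<^sub>R u" "r *\<^sub>R v"]
      by (smt (verit) distrib_left mult_right_mono norm_ge_zero norm_scaleR)
    have tc: "t * (norm u + norm v) < min d1 d2"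
    proof -
      have "t * (norm u + norm v) \<le> t * c" using t by (simp add: c_def)
      also have "\<dots> < d * c" using t c by simp
      finally show ?thesis using c by (simp add: d_def)
    qed
    have near: "x + s *\<^sub>R u + r *\<^sub>R v \<in> U" if "0 \<le> s" "s \<le> t" "0 \<le> r" "r \<le> t" for s r
    proof -
      have "dist x (x + s *\<^sub>R u + r *\<^sub>R v) = norm (s *\<^sub>R u + r *\<^sub>R v)"
        by (simp add: dist_norm norm_minus_commute algebra_simps)
      with small[OF that] tc d2 show ?thesis by (auto simp: subset_iff)
    qed
    \<comment> \<open>The second difference is \<open>\<phi> t - \<phi> 0\<close>, so one
      application of the mean value theorem in \<open>s\<close> suffices.\<close>
    define \<phi> where "\<phi> s = f (x + s *\<^sub>R u + t *\<^sub>R v) - f (x + s *\<^sub>R u)" for s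
    have der1: "((\<lambda>s. f (x + s *\<^sub>R u + r *\<^sub>R v)) has_real_derivative A' (x + s *\<^sub>R u + r *\<^sub>R v)) (at s)"
      if "0 \<le> s" "s \<le> t" "0 \<le> r" "r \<le> t" for s r
    proof -
      have D: "(f has_derivative frechet_derivative f (at (x + s *\<^sub>R u + r *\<^sub>R v))) (at (x + s *\<^sub>R u + r *\<^sub>R v))"
        using f[OF near[OF that]] frechet_derivative_works by blast
      have "((\<lambda>s. f (x + s *\<^sub>R u + r *\<^sub>R v)) has_derivative (\<lambda>k. frechet_derivative f (at (x + s *\<^sub>R u + r *\<^sub>R v)) (k *\<^sub>R u))) (at s)"
        by (rule has_derivative_compose[where f="\<lambda>s. x + s *\<^sub>R u + r *\<^sub>R v", OF _ D])
           (auto intro!: derivative_eq_intros)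
      moreover have "(\<lambda>k. frechet_derivative f (at (x + s *\<^sub>R u + r *\<^sub>R v)) (k *\<^sub>R u)) = (*) (A' (x + s *\<^sub>R u + r *\<^sub>R v))"
        using has_derivative_linear[OF D] by (auto simp: A'_def linear_cmul fun_eq_iff)
      ultimately show ?thesis by (simp add: has_field_derivative_def)
    qed
    have "\<exists>z. 0 < z \<and> z < t \<and> \<phi> t - \<phi> 0 = (t - 0) * (A' (x + z *\<^sub>R u + t *\<^sub>R v) - A' (x + z *\<^sub>R u))"
    proof (rule MVT2)
      fix s assume s: "0 \<le> s" "s \<le> t"
      show "(\<phi> has_real_derivative A' (x + s *\<^sub>R u + t *\<^sub>R v) - A' (x + s *\<^sub>R u)) (at s)"
        unfolding \<phi>_def using der1[of s t] der1[of s 0] s t by (auto intro!: derivative_eq_intros)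
    qed (use t in auto)
    then obtain z where z: "0 < z" "z < t" "\<phi> t - \<phi> 0 = t * (A' (x + z *\<^sub>R u + t *\<^sub>R v) - A' (x + z *\<^sub>R u))" by auto
    have b1: "\<bar>A' (x + z *\<^sub>R u + t *\<^sub>R v) - A' x - L (z *\<^sub>R u + t *\<^sub>R v)\<bar> \<le> e / (2*c) * (t * (norm u + norm v))"
    proof -
      have "\<bar>A' (x + (z *\<^sub>R u + t *\<^sub>R v)) - A' x - L (z *\<^sub>R u + t *\<^sub>R v)\<bar> \<le> e / (2*c) * norm (z *\<^sub>R u + t *\<^sub>R v)"
        using d1(2)[of "x + (z *\<^sub>R u + t *\<^sub>R v)"] small[of z t] tc z t by auto
      also have "\<dots> \<le> e / (2*c) * (t * (norm u + norm v))"
        using small[of z t] z t e c by (intro mult_left_mono) auto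
      finally show ?thesis by (simp add: add.assoc)
    qed
    have b2: "\<bar>A' (x + z *\<^sub>R u) - A' x - L (z *\<^sub>R u)\<bar> \<le> e / (2*c) * (t * norm u)"
    proof -
      have "\<bar>A' (x + z *\<^sub>R u) - A' x - L (z *\<^sub>R u)\<bar> \<le> e / (2*c) * norm (z *\<^sub>R u)"
        using d1(2)[of "x + z *\<^sub>R u"] small[of z 0] tc z t by auto
      also have "\<dots> \<le> e / (2*c) * (t * norm u)"
        using z t e c by (intro mult_left_mono) (auto simp: mult_right_mono)
      finally show ?thesis .
    qed
    have Ladd: "L (z *\<^sub>R u + t *\<^sub>R v) = L (z *\<^sub>R u) + t * L v"
      using lin by (simp add: linear_add linear_cmul)
    have "\<bar>(\<phi> t - \<phi> 0) / t - t * L v\<bar> \<le> e / (2*c) * (t * (2 * norm u + norm v))"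
    proof -
      have "(\<phi> t - \<phi> 0) / t = A' (x + z *\<^sub>R u + t *\<^sub>R v) - A' (x + z *\<^sub>R u)" using z t by simp
      moreover have "e / (2*c) * (t * (2 * norm u + norm v)) = e / (2*c) * (t * (norm u + norm v)) + e / (2*c) * (t * norm u)"
        by (simp add: algebra_simps add_divide_distrib)
      ultimately show ?thesis using b1 b2 Ladd by linarith
    qed
    also have "\<dots> \<le> e / (2*c) * (t * c)" using e c t by (intro mult_left_mono) (auto simp: c_def)
    also have "\<dots> < e * t" using e c t by simp
    finally have *: "\<bar>(\<phi> t - \<phi> 0) / t - t * L v\<bar> < e * t" .
    have "(f (x + t *\<^sub>R u + t *\<^sub>R v) - f (x + t *\<^sub>R u) - f (x + t *\<^sub>R v) + f x) / t\<^sup>2 - L v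
        = ((\<phi> t - \<phi> 0) / t - t * L v) / t"
      using t by (simp add: \<phi>_def field_simps power2_eq_square)
    then show ?thesis using * t by (simp add: abs_divide divide_less_eq)
  qed
  then show "\<forall>\<^sub>F t in at_right 0. dist ((f (x + t *\<^sub>R u + t *\<^sub>R v) - f (x + t *\<^sub>R u) - f (x + t *\<^sub>R v) + f x) / t\<^sup>2) (L v) < e"
    unfolding eventually_at_right_field dist_real_def using d by (intro exI[of _ d]) auto
qed

text \<open>The second difference is symmetric in \<open>u\<close> and \<open>v\<close>, and both
  mixed derivatives are its limit.\<close>

lemma dir_deriv_commute:
  fixes f :: "'e::real_normed_vector \<Rightarrow> real"
  assumes U: "open U" "x \<in> U"
    and f: "\<And>y. y \<in> U \<Longrightarrow> f differentiable (at y)"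
    and u: "(\<lambda>y. dir_deriv f y u) differentiable (at x)"
    and v: "(\<lambda>y. dir_deriv f y v) differentiable (at x)"
  shows "dir_deriv (\<lambda>y. dir_deriv f y u) x v = dir_deriv (\<lambda>y. dir_deriv f y v) x u"
proof -
  note * = second_difference_quotient_tendsto[OF U f]
  have 1: "((\<lambda>t. (f (x + t *\<^sub>R u + t *\<^sub>R v) - f (x + t *\<^sub>R u) - f (x + t *\<^sub>R v) + f x) / t\<^sup>2)
           \<longlongrightarrow> dir_deriv (\<lambda>y. dir_deriv f y u) x v) (at_right 0)"
    using *[OF _ u[unfolded frechet_derivative_works]] .
  have "((\<lambda>t. (f (x + t *\<^sub>R v + t *\<^sub>R u) - f (x + t *\<^sub>R v) - f (x + t *\<^sub>R u) + f x) / t\<^sup>2)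
           \<longlongrightarrow> dir_deriv (\<lambda>y. dir_deriv f y v) x u) (at_right 0)"
    using *[OF _ v[unfolded frechet_derivative_works]] .
  moreover have "(\<lambda>t. (f (x + t *\<^sub>R v + t *\<^sub>R u) - f (x + t *\<^sub>R v) - f (x + t *\<^sub>R u) + f x) / t\<^sup>2)
     = (\<lambda>t. (f (x + t *\<^sub>R u + t *\<^sub>R v) - f (x + t *\<^sub>R u) - f (x + t *\<^sub>R v) + f x) / t\<^sup>2)"
    by (simp add: algebra_simps)
  ultimately show ?thesis using 1 by (intro tendsto_unique[OF trivial_limit_at_right_real]) auto
qed

text \<open>A product rule in which only \<open>\<lambda>x. B x v\<close> for fixed \<open>v\<close>
  is known to be differentiable. Expanding the moving vector in the standard basis leaves finitely
  many fixed vectors.\<close>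

lemma has_derivative_linear_family:
  fixes B :: "'e::real_normed_vector \<Rightarrow> 'f::euclidean_space \<Rightarrow> 'g::real_normed_vector"
  assumes U: "open U" "y t \<in> U"
    and lin: "\<And>x. x \<in> U \<Longrightarrow> linear (B x)"
    and B: "\<And>v. (\<lambda>x. B x v) differentiable (at (y t))"
    and y: "(y has_derivative y') (at t)"
    and a: "(a has_derivative a') (at t)"
  shows "((\<lambda>s. B (y s) (a s)) has_derivative
            (\<lambda>s. dir_deriv (\<lambda>x. B x (a t)) (y t) (y' s) + B (y t) (a' s))) (at t)"
proof -
  have expand: "B x v = (\<Sum>b\<in>Basis. (v \<bullet> b) *\<^sub>R B x b)" if "x \<in> U" for x v
  proof -
    have "B x v = B x (\<Sum>b\<in>Basis. (v \<bullet> b) *\<^sub>R b)" by (simp add: euclidean_representation)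
    also have "\<dots> = (\<Sum>b\<in>Basis. (v \<bullet> b) *\<^sub>R B x b)"
      using lin[OF that] by (simp add: linear_sum linear_cmul)
    finally show ?thesis .
  qed
  have D: "((\<lambda>x. B x v) has_derivative frechet_derivative (\<lambda>x. B x v) (at (y t))) (at (y t))" for v
    using B frechet_derivative_works by blast
  have DB: "((\<lambda>s. B (y s) b) has_derivative (\<lambda>s. dir_deriv (\<lambda>x. B x b) (y t) (y' s))) (at t)" for b
    by (rule has_derivative_compose[OF y D])
  have 1: "((\<lambda>s. \<Sum>b\<in>Basis. (a s \<bullet> b) *\<^sub>R B (y s) b) has_derivative
     (\<lambda>s. \<Sum>b\<in>Basis. (a t \<bullet> b) *\<^sub>R dir_deriv (\<lambda>x. B x b) (y t) (y' s) + (a' s \<bullet> b) *\<^sub>R B (y t) b)) (at t)"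
    by (intro has_derivative_sum has_derivative_scaleR has_derivative_inner_left a DB)
  have ev: "\<forall>\<^sub>F s in at t. y s \<in> U"
    using has_derivative_continuous[OF y] U by (auto simp: continuous_at isCont_def intro: topological_tendstoD)
  have 2: "((\<lambda>s. B (y s) (a s)) has_derivative
     (\<lambda>s. \<Sum>b\<in>Basis. (a t \<bullet> b) *\<^sub>R dir_deriv (\<lambda>x. B x b) (y t) (y' s) + (a' s \<bullet> b) *\<^sub>R B (y t) b)) (at t)"
    by (rule has_derivative_transform_eventually[OF 1])
       (use ev in \<open>auto elim!: eventually_mono simp: expand U\<close>)
  have 3: "dir_deriv (\<lambda>x. B x (a t)) (y t) w = (\<Sum>b\<in>Basis. (a t \<bullet> b) *\<^sub>R dir_deriv (\<lambda>x. B x b) (y t) w)" for w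
  proof -
    have "((\<lambda>x. \<Sum>b\<in>Basis. (a t \<bullet> b) *\<^sub>R B x b) has_derivative
       (\<lambda>w. \<Sum>b\<in>Basis. (a t \<bullet> b) *\<^sub>R dir_deriv (\<lambda>x. B x b) (y t) w)) (at (y t))"
      by (intro has_derivative_sum has_derivative_scaleR_right D)
    then have "((\<lambda>x. B x (a t)) has_derivative
       (\<lambda>w. \<Sum>b\<in>Basis. (a t \<bullet> b) *\<^sub>R dir_deriv (\<lambda>x. B x b) (y t) w)) (at (y t))"
      by (rule has_derivative_transform_within_open[OF _ U]) (simp add: expand)
    from frechet_derivative_at[OF this] show ?thesis by (simp add: fun_eq_iff)
  qed
  have 4: "B (y t) (a' s) = (\<Sum>b\<in>Basis. (a' s \<bullet> b) *\<^sub>R B (y t) b)" for s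
    using expand U by blast
  show ?thesis using 2 by (simp add: 3 4 sum.distrib)
qed

text \<open>Since \<open>f y\<close> is O(\<open>norm (y - x)\<close>) near its zero
  \<open>x\<close>, replacing \<open>g y\<close> by \<open>g x\<close> costs only
  o(\<open>norm (y - x)\<close>). This later upgrades continuity of the Christoffel symbols to
  differentiability.\<close>

lemma has_derivative_mult_vanishing:
  fixes f g :: "'e::real_normed_vector \<Rightarrow> real"
  assumes f: "(f has_derivative f') (at x)" "f x = 0" and g: "isCont g x"
  shows "((\<lambda>y. f y * g y) has_derivative (\<lambda>v. f' v * g x)) (at x)"
proof -
  have bl: "bounded_linear f'" using f has_derivative_bounded_linear by blast
  have "((\<lambda>y. (f y - f x - f' (y - x)) / norm (y - x)) \<longlongrightarrow> 0) (at x)"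
    using f(1) by (simp add: has_derivative_at_within divide_inverse mult.commute)
  then have 1: "((\<lambda>y. (f y - f x - f' (y - x)) / norm (y - x) * g y) \<longlongrightarrow> 0 * g x) (at x)"
    using g by (intro tendsto_mult) (auto simp: isCont_def)
  obtain K where K: "\<And>v. norm (f' v) \<le> norm v * K" and K0: "K \<ge> 0"
    using bounded_linear.nonneg_bounded[OF bl] by blast
  have "((\<lambda>y. f' (y - x) / norm (y - x) * (g y - g x)) \<longlongrightarrow> 0) (at x)"
  proof (rule Lim_null_comparison)
    show "\<forall>\<^sub>F y in at x. norm (f' (y - x) / norm (y - x) * (g y - g x)) \<le> K * \<bar>g y - g x\<bar>"
    proof (rule always_eventually, rule allI)
      fix y
      have "norm (f' (y - x) / norm (y - x)) \<le> K"
        using K[of "y - x"] K0 by (cases "y = x") (auto simp: divide_le_eq mult.commute)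
      then show "norm (f' (y - x) / norm (y - x) * (g y - g x)) \<le> K * \<bar>g y - g x\<bar>"
        using mult_right_mono[OF _ abs_ge_zero[of "g y - g x"]] by (simp only: norm_mult real_norm_def abs_mult)
    qed
    have "((\<lambda>y. K * \<bar>g y - g x\<bar>) \<longlongrightarrow> K * \<bar>g x - g x\<bar>) (at x)"
      using g by (intro tendsto_intros) (auto simp: isCont_def)
    then show "((\<lambda>y. K * \<bar>g y - g x\<bar>) \<longlongrightarrow> 0) (at x)" by simp
  qed
  from tendsto_add[OF 1 this]
  have "((\<lambda>y. (f y * g y - f x * g x - f' (y - x) * g x) / norm (y - x)) \<longlongrightarrow> 0) (at x)"
    by (simp add: f(2) algebra_simps diff_divide_distrib add_divide_distrib)
  then show ?thesis
    using bl by (simp add: has_derivative_at_within divide_inverse mult.commute bounded_linear_mult_const)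
qed

text \<open>\<open>frechet_derivative\<close> chooses among all derivatives at \<open>x\<close>, and
  both functions have the same ones; the case of no derivative is thereby covered.\<close>

lemma dir_deriv_cong_open:
  assumes "open U" "x \<in> U" "\<And>y. y \<in> U \<Longrightarrow> f y = g y"
  shows "dir_deriv f x u = dir_deriv g x u"
proof -
  have "(f has_derivative f') (at x) \<longleftrightarrow> (g has_derivative f') (at x)" for f'
    using assms has_derivative_transform_within_open[of f f' x UNIV U g]
      has_derivative_transform_within_open[of g f' x UNIV U f] by auto
  then show ?thesis by (simp add: frechet_derivative_def)
qed

lemma dir_deriv_eq:
  "(f has_derivative f') (at x) \<Longrightarrow> dir_deriv f x u = f' u"
  by (metis frechet_derivative_at)

lemma differentiable_at_eq_open:
  assumes "f differentiable (at x)" "open U" "x \<in> U" "\<And>y. y \<in> U \<Longrightarrow> f y = g y"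
  shows "g differentiable (at x)"
  using assms has_derivative_transform_within_open[of f _ x UNIV U g] unfolding differentiable_def by blast

lemma dir_deriv_linear_family:
  fixes B :: "'e::real_normed_vector \<Rightarrow> 'f::real_vector \<Rightarrow> 'g::real_normed_vector"
  assumes U: "open U" "x \<in> U"
    and lin: "\<And>y. y \<in> U \<Longrightarrow> linear (B y)"
    and B: "\<And>v. (\<lambda>y. B y v) differentiable (at x)"
  shows "linear (\<lambda>v. dir_deriv (\<lambda>y. B y v) x u)"
proof (rule linearI)
  note D = B[unfolded frechet_derivative_works]
  fix v w :: 'f and a :: real
  have "dir_deriv (\<lambda>y. B y (v + w)) x u = dir_deriv (\<lambda>y. B y v + B y w) x u"
    by (rule dir_deriv_cong_open[OF U]) (simp add: lin linear_add)
  also have "\<dots> = dir_deriv (\<lambda>y. B y v) x u + dir_deriv (\<lambda>y. B y w) x u"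
    by (rule dir_deriv_eq[OF has_derivative_add[OF D D]])
  finally show "dir_deriv (\<lambda>y. B y (v + w)) x u = dir_deriv (\<lambda>y. B y v) x u + dir_deriv (\<lambda>y. B y w) x u" .
  have "dir_deriv (\<lambda>y. B y (a *\<^sub>R v)) x u = dir_deriv (\<lambda>y. a *\<^sub>R B y v) x u"
    by (rule dir_deriv_cong_open[OF U]) (simp add: lin linear_cmul)
  also have "\<dots> = a *\<^sub>R dir_deriv (\<lambda>y. B y v) x u"
    by (rule dir_deriv_eq[OF has_derivative_scaleR_right[OF D]])
  finally show "dir_deriv (\<lambda>y. B y (a *\<^sub>R v)) x u = a *\<^sub>R dir_deriv (\<lambda>y. B y v) x u" .
qed

section \<open>Inner products\<close>

locale inner_form =
  fixes b :: "'e::euclidean_space \<Rightarrow> 'e \<Rightarrow> real"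
  assumes linear_left: "linear (\<lambda>u. b u w)"
    and sym: "b u v = b v u"
    and pos: "u \<noteq> 0 \<Longrightarrow> 0 < b u u"
begin

lemma linear_right: "linear (b u)"
proof -
  have "b u = (\<lambda>w. b w u)" using sym by auto
  then show ?thesis using linear_left by simp
qed

definition orthonormal :: "'e set \<Rightarrow> bool" where
  "orthonormal S \<longleftrightarrow> (\<forall>e\<in>S. \<forall>f\<in>S. b e f = (if e = f then 1 else 0))"

lemma coefficient_orthonormal:
  assumes "finite S" "orthonormal S" "f \<in> S"
  shows "b (\<Sum>e\<in>S. a e *\<^sub>R e) f = a f"
proof -
  have "b (\<Sum>e\<in>S. a e *\<^sub>R e) f = (\<Sum>e\<in>S. a e * b e f)"
    using linear_left by (simp add: linear_sum[OF linear_left] linear_cmul[OF linear_left])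
  also have "\<dots> = (\<Sum>e\<in>S. if e = f then a f else 0)"
    using assms by (intro sum.cong) (auto simp: orthonormal_def)
  finally show ?thesis using assms by simp
qed

lemma independent_orthonormal:
  assumes "finite S" "orthonormal S"
  shows "independent S"
  using assms coefficient_orthonormal linear_0[OF linear_left]
  by (subst independent_explicit_module) (auto, metis coefficient_orthonormal finite_subset orthonormal_def subsetD)

lemma nondegenerate: "(\<And>z. b u z = b v z) \<Longrightarrow> u = v"
  using pos[of "u - v"] linear_diff[OF linear_left, of u v] by force

text \<open>Orthonormal sets are independent, so their size is bounded and a largest one containing
  \<open>S0\<close> exists. A nonzero remainder of some \<open>w\<close> could be normalised and
  added to it.\<close>

lemma orthonormal_basis_extending:
  assumes S0: "finite S0" "orthonormal S0"
  shows "\<exists>S. finite S \<and> S0 \<subseteq> S \<and> orthonormal S \<and> (\<forall>w. (\<Sum>e\<in>S. b w e *\<^sub>R e) = w)"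
proof -
  let ?P = "\<lambda>S. finite S \<and> S0 \<subseteq> S \<and> orthonormal S"
  have "card S < DIM('e) + 1" if "?P S" for S
    using that independent_orthonormal independent_bound by (metis less_Suc_eq_le Suc_eq_plus1)
  then obtain S where S: "?P S" "\<And>T. ?P T \<Longrightarrow> card T \<le> card S"
    using ex_has_greatest_nat[of ?P S0 card "DIM('e) + 1"] S0 by auto
  have "(\<Sum>e\<in>S. b w e *\<^sub>R e) = w" for w
  proof (rule ccontr)
    define r where "r = w - (\<Sum>e\<in>S. b w e *\<^sub>R e)"
    assume "(\<Sum>e\<in>S. b w e *\<^sub>R e) \<noteq> w"
    then have r0: "b r r > 0" using pos by (simp add: r_def)
    have re: "b r e = 0" if "e \<in> S" for e
      using coefficient_orthonormal[of S e "b w"] S that by (simp add: r_def linear_diff[OF linear_left])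
    define n where "n = (1 / sqrt (b r r)) *\<^sub>R r"
    have nn: "b n n = 1"
      using r0 by (simp add: n_def linear_cmul[OF linear_left] linear_cmul[OF linear_right])
    have ne: "b n e = 0" if "e \<in> S" for e
      using re[OF that] by (simp add: n_def linear_cmul[OF linear_left])
    have "n \<notin> S" using nn ne by force
    moreover have "?P (insert n S)"
      using S nn ne sym unfolding orthonormal_def by auto
    ultimately show False using S(2)[of "insert n S"] S(1) by simp
  qed
  with S show ?thesis by blast
qed

lemma orthonormal_basis:
  "\<exists>S. finite S \<and> orthonormal S \<and> (\<forall>w. (\<Sum>e\<in>S. b w e *\<^sub>R e) = w)"
proof -
  have "orthonormal {}" by (simp add: orthonormal_def)
  from orthonormal_basis_extending[OF finite.emptyI this] show ?thesis by blast
qed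

text \<open>Moves the trace in the definition of the Ricci curvature from the coordinate basis to a
  basis adapted to the metric. Each \<open>a\<close> is expanded in \<open>S\<close> and the two
  sums are exchanged.\<close>

lemma trace_orthonormal:
  assumes S: "finite S" "\<And>w. (\<Sum>e\<in>S. b w e *\<^sub>R e) = w" and L: "linear L"
  shows "(\<Sum>a\<in>Basis. L a \<bullet> a) = (\<Sum>e\<in>S. b (L e) e)"
proof -
  have "L a \<bullet> a = (\<Sum>e\<in>S. b a e * (L e \<bullet> a))" for a
  proof -
    have "L a = (\<Sum>e\<in>S. b a e *\<^sub>R L e)"
      by (subst S(2)[of a, symmetric]) (simp add: linear_sum[OF L] linear_cmul[OF L])
    then show ?thesis by (simp add: inner_sum_left)
  qed
  then have "(\<Sum>a\<in>Basis. L a \<bullet> a) = (\<Sum>e\<in>S. \<Sum>a\<in>Basis. (L e \<bullet> a) * b a e)"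
    by (subst sum.swap) (simp add: mult.commute)
  also have "\<dots> = (\<Sum>e\<in>S. b (\<Sum>a\<in>Basis. (L e \<bullet> a) *\<^sub>R a) e)"
    by (simp add: linear_sum[OF linear_left] linear_cmul[OF linear_left])
  finally show ?thesis by (simp add: euclidean_representation)
qed

text \<open>The representing vector has the coefficients \<open>\<phi> e\<close> in an orthonormal
  basis. Unique existence is what gives meaning to the \<open>THE\<close> in
  \<open>christoffel\<close>.\<close>

lemma riesz:
  assumes "linear \<phi>"
  shows "\<exists>!w. \<forall>z. b w z = \<phi> z"
proof -
  obtain S where S: "finite S" "orthonormal S" "\<And>w. (\<Sum>e\<in>S. b w e *\<^sub>R e) = w"
    using orthonormal_basis by blast
  have "b (\<Sum>e\<in>S. \<phi> e *\<^sub>R e) z = \<phi> z" for z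
  proof -
    have "b (\<Sum>e\<in>S. \<phi> e *\<^sub>R e) z = (\<Sum>e\<in>S. \<phi> e * b z e)"
      by (simp add: linear_sum[OF linear_left] linear_cmul[OF linear_left] sym[of z])
    also have "\<dots> = \<phi> (\<Sum>e\<in>S. b z e *\<^sub>R e)"
      by (simp add: linear_sum[OF assms] linear_cmul[OF assms] mult.commute)
    finally show ?thesis using S(3)[of z] by simp
  qed
  then show ?thesis by (intro ex1I[of _ "\<Sum>e\<in>S. \<phi> e *\<^sub>R e"] allI nondegenerate) simp_all
qed

end

section \<open>The Levi-Civita connection\<close>

text \<open>The coordinate picture of a Riemannian manifold: \<open>U\<close> will be a chart image
  and \<open>h\<close> the local metric.\<close>

locale riemannian_domain =
  fixes U :: "'e::euclidean_space set" and h :: "'e \<Rightarrow> 'e \<Rightarrow> 'e \<Rightarrow> real"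
  assumes open_U: "open U"
    and form: "x \<in> U \<Longrightarrow> inner_form (h x)"
    and smooth: "smooth_on U (\<lambda>x. h x u v)"
begin

abbreviation dh :: "'e \<Rightarrow> 'e \<Rightarrow> 'e \<Rightarrow> 'e \<Rightarrow> real" where
  "dh x u v w \<equiv> dir_deriv (\<lambda>y. h y v w) x u"

abbreviation \<Gamma> :: "'e \<Rightarrow> 'e \<Rightarrow> 'e \<Rightarrow> 'e" where
  "\<Gamma> \<equiv> christoffel h"

lemma linear_left: "x \<in> U \<Longrightarrow> linear (\<lambda>u. h x u w)"
  using form inner_form.linear_left by blast

lemma linear_right: "x \<in> U \<Longrightarrow> linear (h x u)"
  using form inner_form.linear_right by blast

lemma h_sym: "x \<in> U \<Longrightarrow> h x u v = h x v u"
  using form inner_form.sym by blast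

lemma nondegenerate: "x \<in> U \<Longrightarrow> (\<And>z. h x u z = h x v z) \<Longrightarrow> u = v"
  using form inner_form.nondegenerate by blast

lemma C2: "Ck_on (Suc (Suc 0)) U (\<lambda>x. h x u v)"
  using smooth smooth_on_def by blast

lemma differentiable_h: "x \<in> U \<Longrightarrow> (\<lambda>y. h y v w) differentiable (at x)"
  using C2[of v w] by simp

lemma differentiable_dh: "x \<in> U \<Longrightarrow> (\<lambda>y. dh y u v w) differentiable (at x)"
  using C2[of v w] by simp

lemma dh_linear1: "x \<in> U \<Longrightarrow> linear (\<lambda>u. dh x u v w)"
  by (rule linear_frechet_derivative) (rule differentiable_h)

lemma dh_linear2: "x \<in> U \<Longrightarrow> linear (\<lambda>v. dh x u v w)"
  using dir_deriv_linear_family[OF open_U _ linear_left differentiable_h] by blast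

lemma dh_linear3: "x \<in> U \<Longrightarrow> linear (\<lambda>w. dh x u v w)"
  using dir_deriv_linear_family[OF open_U _ linear_right differentiable_h] by blast

lemma dh_sym: "x \<in> U \<Longrightarrow> dh x u v w = dh x u w v"
  by (rule dir_deriv_cong_open[OF open_U]) (auto simp: h_sym)

text \<open>The right-hand side is linear in \<open>z\<close>, so \<open>riesz\<close> provides the
  unique vector that \<open>christoffel\<close> denotes.\<close>

lemma koszul:
  assumes x: "x \<in> U"
  shows "2 * h x (\<Gamma> x u v) z = dh x u v z + dh x v u z - dh x z u v"
proof -
  let ?K = "\<lambda>z. dh x u v z + dh x v u z - dh x z u v"
  have "linear (\<lambda>z. ?K z / 2)"
    by (intro linearI) (simp_all add: linear_add[OF dh_linear3[OF x]] linear_cmul[OF dh_linear3[OF x]]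
      linear_add[OF dh_linear1[OF x]] linear_cmul[OF dh_linear1[OF x]] field_simps)
  then have "\<exists>!w. \<forall>z. h x w z = ?K z / 2"
    by (rule inner_form.riesz[OF form[OF x]])
  moreover have "(a = k / 2) = (2 * a = k)" for a k :: real by auto
  ultimately have "\<exists>!w. \<forall>z. 2 * h x w z = ?K z" by (simp only:)
  from theI'[OF this] show ?thesis unfolding christoffel_def by blast
qed

lemma christoffel_sym:
  assumes x: "x \<in> U"
  shows "\<Gamma> x u v = \<Gamma> x v u"
proof (rule nondegenerate[OF x])
  fix z show "h x (\<Gamma> x u v) z = h x (\<Gamma> x v u) z"
    using koszul[OF x, of u v z] koszul[OF x, of v u z] dh_sym[OF x, of u v z] by linarith
qed

lemma christoffel_linear2:
  assumes x: "x \<in> U"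
  shows "linear (\<Gamma> x u)"
proof (rule linearI)
  note l = linear_add[OF linear_left[OF x]] linear_cmul[OF linear_left[OF x]]
    linear_add[OF dh_linear1[OF x]] linear_cmul[OF dh_linear1[OF x]]
    linear_add[OF dh_linear2[OF x]] linear_cmul[OF dh_linear2[OF x]]
    linear_add[OF dh_linear3[OF x]] linear_cmul[OF dh_linear3[OF x]]
  fix v w and a :: real
  show "\<Gamma> x u (v + w) = \<Gamma> x u v + \<Gamma> x u w"
  proof (rule nondegenerate[OF x])
    fix z show "h x (\<Gamma> x u (v + w)) z = h x (\<Gamma> x u v + \<Gamma> x u w) z"
      using koszul[OF x, of u v z] koszul[OF x, of u w z] koszul[OF x, of u "v + w" z] by (simp add: l)
  qed
  show "\<Gamma> x u (a *\<^sub>R v) = a *\<^sub>R \<Gamma> x u v"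
  proof (rule nondegenerate[OF x])
    fix z
    have "2 * h x (\<Gamma> x u (a *\<^sub>R v)) z = a * (2 * h x (\<Gamma> x u v) z)"
      unfolding koszul[OF x] by (simp add: l algebra_simps)
    then show "h x (\<Gamma> x u (a *\<^sub>R v)) z = h x (a *\<^sub>R \<Gamma> x u v) z" by (simp add: l)
  qed
qed

lemma christoffel_linear1:
  assumes x: "x \<in> U"
  shows "linear (\<lambda>u. \<Gamma> x u v)"
  unfolding christoffel_sym[OF x, of _ v] by (rule christoffel_linear2[OF x])

text \<open>In the sum of the Koszul identities for \<open>(u, v, w)\<close> and
  \<open>(u, w, v)\<close> the derivatives of \<open>h\<close> along \<open>v\<close> and
  \<open>w\<close> cancel.\<close>

lemma metric_compatible:
  assumes x: "x \<in> U"
  shows "dh x u v w = h x (\<Gamma> x u v) w + h x v (\<Gamma> x u w)"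
  using koszul[OF x, of u v w] koszul[OF x, of u w v] dh_sym[OF x, of v w u] h_sym[OF x, of v "\<Gamma> x u w"]
  by linarith

text \<open>\<open>\<Gamma> y u v\<close> solves a linear system that is a small perturbation of the
  one at \<open>x\<close>. Absorbing the perturbation bounds the solution near \<open>x\<close>;
  boundedness gives continuity at \<open>x\<close>, and continuity gives differentiability, because
  each unknown component carries a factor \<open>H\<close> that vanishes at
  \<open>x\<close>.\<close>

lemma differentiable_christoffel:
  assumes x: "x \<in> U"
  shows "(\<lambda>y. \<Gamma> y u v) differentiable (at x)"
proof -
  obtain S where S: "finite S" "\<And>w. (\<Sum>e\<in>S. h x w e *\<^sub>R e) = w"
    using inner_form.orthonormal_basis[OF form[OF x]] by blast
  define K where "K y e = (dh y u v e + dh y v u e - dh y e u v) / 2" for y e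
  define H where "H y a e = h y a e - h x a e" for y a e
  have diffK: "(\<lambda>y. K y e) differentiable (at x)" for e
    unfolding K_def divide_inverse using x
    by (intro differentiable_mult differentiable_diff differentiable_add differentiable_dh differentiable_const)
  have diffH: "(\<lambda>y. H y a e) differentiable (at x)" for a e
    unfolding H_def using x by (intro differentiable_diff differentiable_h differentiable_const)
  have Hx: "H x a e = 0" for a e by (simp add: H_def)
  have Hlim: "((\<lambda>y. H y a e) \<longlongrightarrow> 0) (at x)" for a e
    using differentiable_imp_continuous_within[OF diffH[of a e]] Hx by (simp add: continuous_within)
  have Klim: "((\<lambda>y. K y e) \<longlongrightarrow> K x e) (at x)" for e
    using differentiable_imp_continuous_within[OF diffK[of e]] by (simp add: continuous_within)
  text \<open>The Koszul system at \<open>y\<close>, solved for \<open>\<Gamma> y u v\<close> with the inverse of the metric at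
    the fixed point \<open>x\<close> only.\<close>
  have coeff: "h x (\<Gamma> y u v) e = K y e - (\<Sum>a\<in>Basis. H y a e * (\<Gamma> y u v \<bullet> a))" if y: "y \<in> U" for y e
  proof -
    have *: "h z w e = (\<Sum>a\<in>Basis. h z a e * (w \<bullet> a))" if z: "z \<in> U" for z w
    proof -
      have "h z w e = h z (\<Sum>a\<in>Basis. (w \<bullet> a) *\<^sub>R a) e" by (simp add: euclidean_representation)
      then show ?thesis
        by (simp only: linear_sum[OF linear_left[OF z]] linear_cmul[OF linear_left[OF z]] mult.commute real_scaleR_def)
    qed
    have "K y e = h y (\<Gamma> y u v) e" using koszul[OF y, of u v e] by (simp add: K_def)
    then show ?thesis
      using *[OF y, of "\<Gamma> y u v"] *[OF x, of "\<Gamma> y u v"] by (simp add: H_def left_diff_distrib sum_subtractf)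
  qed
  have expand: "\<Gamma> y u v = (\<Sum>e\<in>S. (K y e - (\<Sum>a\<in>Basis. H y a e * (\<Gamma> y u v \<bullet> a))) *\<^sub>R e)" if y: "y \<in> U" for y
    using S(2)[of "\<Gamma> y u v"] coeff[OF y] by simp
  have evU: "\<forall>\<^sub>F y in at x. y \<in> U"
    using open_U x eventually_at_topological by blast
  \<comment> \<open>The system yields \<open>norm (\<Gamma> y u v) \<le> \<kappa> y + \<epsilon> y *
    norm (\<Gamma> y u v)\<close>. Near \<open>x\<close>, \<open>\<epsilon> y < 1 / 2\<close>, so
    the last term is absorbed on the left.\<close>
  define \<epsilon> where "\<epsilon> y = (\<Sum>e\<in>S. (\<Sum>a\<in>Basis. \<bar>H y a e\<bar>) * norm e)" for y
  define \<kappa> where "\<kappa> y = (\<Sum>e\<in>S. \<bar>K y e\<bar> * norm e)" for y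
  have "(\<epsilon> \<longlongrightarrow> (\<Sum>e\<in>S. (\<Sum>a::'e\<in>Basis. \<bar>0\<bar>) * norm e)) (at x)"
    unfolding \<epsilon>_def by (intro tendsto_intros Hlim)
  then have "(\<epsilon> \<longlongrightarrow> 0) (at x)" by simp
  then have ev1: "\<forall>\<^sub>F y in at x. \<epsilon> y < 1 / 2" by (rule order_tendstoD) simp
  have "(\<kappa> \<longlongrightarrow> \<kappa> x) (at x)"
    unfolding \<kappa>_def by (intro tendsto_intros Klim)
  then have ev2: "\<forall>\<^sub>F y in at x. \<kappa> y < \<kappa> x + 1" by (rule order_tendstoD) simp
  have bound: "\<forall>\<^sub>F y in at x. norm (\<Gamma> y u v) \<le> 2 * (\<kappa> x + 1)"
    using evU ev1 ev2
  proof eventually_elim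
    case (elim y)
    let ?N = "norm (\<Gamma> y u v)"
    have "?N \<le> (\<Sum>e\<in>S. norm ((K y e - (\<Sum>a\<in>Basis. H y a e * (\<Gamma> y u v \<bullet> a))) *\<^sub>R e))"
      by (subst expand[OF elim(1)]) (rule norm_sum)
    also have "\<dots> \<le> (\<Sum>e\<in>S. (\<bar>K y e\<bar> + (\<Sum>a\<in>Basis. \<bar>H y a e\<bar>) * ?N) * norm e)"
    proof (rule sum_mono)
      fix e assume "e \<in> S"
      have "\<bar>\<Sum>a\<in>Basis. H y a e * (\<Gamma> y u v \<bullet> a)\<bar> \<le> (\<Sum>a\<in>Basis. \<bar>H y a e\<bar> * ?N)"
        by (rule order_trans[OF sum_abs]) (auto intro!: sum_mono mult_left_mono simp: abs_mult Basis_le_norm)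
      then have "\<bar>K y e - (\<Sum>a\<in>Basis. H y a e * (\<Gamma> y u v \<bullet> a))\<bar> \<le> \<bar>K y e\<bar> + (\<Sum>a\<in>Basis. \<bar>H y a e\<bar>) * ?N"
        by (simp add: sum_distrib_right)
      then show "norm ((K y e - (\<Sum>a\<in>Basis. H y a e * (\<Gamma> y u v \<bullet> a))) *\<^sub>R e)
        \<le> (\<bar>K y e\<bar> + (\<Sum>a\<in>Basis. \<bar>H y a e\<bar>) * ?N) * norm e"
        by (simp add: mult_right_mono)
    qed
    also have "\<dots> = \<kappa> y + \<epsilon> y * ?N"
      by (simp add: \<kappa>_def \<epsilon>_def sum.distrib sum_distrib_left[of "norm (\<Gamma> y u v)" _ S] algebra_simps)
    also have "\<dots> \<le> (\<kappa> x + 1) + 1 / 2 * ?N" using elim by (intro add_mono mult_right_mono) auto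
    finally show ?case by simp
  qed
  \<comment> \<open>A factor tending to 0 times a bounded one: the perturbation disappears in the
    limit, which leaves the system at \<open>x\<close>.\<close>
  have prodlim: "((\<lambda>y. H y a e * (\<Gamma> y u v \<bullet> a')) \<longlongrightarrow> 0) (at x)" if "a' \<in> Basis" for a e a'
  proof (rule Lim_null_comparison)
    show "\<forall>\<^sub>F y in at x. norm (H y a e * (\<Gamma> y u v \<bullet> a')) \<le> \<bar>H y a e\<bar> * (2 * (\<kappa> x + 1))"
      using bound
    proof eventually_elim
      case (elim y)
      then have "\<bar>\<Gamma> y u v \<bullet> a'\<bar> \<le> 2 * (\<kappa> x + 1)" using Basis_le_norm[OF that, of "\<Gamma> y u v"] by linarith
      then show ?case unfolding real_norm_def abs_mult by (rule mult_left_mono) simp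
    qed
    have "((\<lambda>y. \<bar>H y a e\<bar> * (2 * (\<kappa> x + 1))) \<longlongrightarrow> \<bar>0\<bar> * (2 * (\<kappa> x + 1))) (at x)"
      by (intro tendsto_intros Hlim)
    then show "((\<lambda>y. \<bar>H y a e\<bar> * (2 * (\<kappa> x + 1))) \<longlongrightarrow> 0) (at x)" by simp
  qed
  have "((\<lambda>y. \<Sum>e\<in>S. (K y e - (\<Sum>a\<in>Basis. H y a e * (\<Gamma> y u v \<bullet> a))) *\<^sub>R e)
      \<longlongrightarrow> (\<Sum>e\<in>S. (K x e - (\<Sum>a::'e\<in>Basis. 0)) *\<^sub>R e)) (at x)"
    by (intro tendsto_intros Klim prodlim)
  moreover have "(\<Sum>e\<in>S. (K x e - (\<Sum>a::'e\<in>Basis. 0)) *\<^sub>R e) = \<Gamma> x u v"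
    using expand[OF x] by (simp add: Hx)
  ultimately have "((\<lambda>y. \<Sum>e\<in>S. (K y e - (\<Sum>a\<in>Basis. H y a e * (\<Gamma> y u v \<bullet> a))) *\<^sub>R e) \<longlongrightarrow> \<Gamma> x u v) (at x)"
    by simp
  then have "((\<lambda>y. \<Gamma> y u v) \<longlongrightarrow> \<Gamma> x u v) (at x)"
    by (rule Lim_transform_eventually) (use evU in \<open>auto elim!: eventually_mono simp: expand[symmetric]\<close>)
  then have cont: "isCont (\<lambda>y. \<Gamma> y u v \<bullet> a) x" for a
    by (simp add: isCont_def tendsto_inner)
  have diffprod: "(\<lambda>y. H y a e * (\<Gamma> y u v \<bullet> a)) differentiable (at x)" for a e
    using has_derivative_mult_vanishing[OF diffH[unfolded frechet_derivative_works] Hx cont]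
    unfolding differentiable_def by blast
  have "(\<lambda>y. \<Sum>e\<in>S. (K y e - (\<Sum>a\<in>Basis. H y a e * (\<Gamma> y u v \<bullet> a))) *\<^sub>R e) differentiable (at x)"
    by (intro differentiable_sum ballI differentiable_scaleR differentiable_diff diffK diffprod differentiable_const S(1) finite_Basis)
  then show ?thesis
    by (rule differentiable_at_eq_open[OF _ open_U x]) (rule expand[symmetric])
qed

end

section \<open>Curvature symmetries\<close>

text \<open>The classical argument: the Bianchi identities for the four cyclic shifts of
  \<open>(a, b, c, d)\<close> are combined, and the antisymmetries remove all terms except those of
  the claim.\<close>

lemma curvature_pair_symmetry:
  fixes T :: "'e \<Rightarrow> 'e \<Rightarrow> 'e \<Rightarrow> 'e \<Rightarrow> real"
  assumes anti12: "\<And>a b c d. T a b c d = - T b a c d"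
    and anti34: "\<And>a b c d. T a b c d = - T a b d c"
    and bianchi: "\<And>a b c d. T a b c d + T b c a d + T c a b d = 0"
  shows "T a b c d = T c d a b"
  using bianchi[of a b c d] bianchi[of b c d a] bianchi[of c d a b] bianchi[of d a b c]
    anti12[of c a b d] anti12[of d b c a] anti12[of a c d b] anti12[of b d a c]
    anti12[of b c a d] anti12[of c d b a] anti12[of d a c b] anti12[of a b d c]
    anti34[of a b c d] anti34[of b c d a] anti34[of c d a b] anti34[of d a b c]
    anti34[of a c b d] anti34[of a c d b] anti34[of b d a c] anti34[of b d c a]
    anti34[of b c a d] anti34[of c d b a] anti34[of d a c b] anti34[of a b d c]
  by linarith

context riemannian_domain
begin

abbreviation d\<Gamma> :: "'e \<Rightarrow> 'e \<Rightarrow> 'e \<Rightarrow> 'e \<Rightarrow> 'e" where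
  "d\<Gamma> x u v w \<equiv> dir_deriv (\<lambda>y. \<Gamma> y v w) x u"

abbreviation R :: "'e \<Rightarrow> 'e \<Rightarrow> 'e \<Rightarrow> 'e \<Rightarrow> 'e" where
  "R \<equiv> curvature_op h"

lemma dchristoffel_linear1: "x \<in> U \<Longrightarrow> linear (\<lambda>u. d\<Gamma> x u v w)"
  by (rule linear_frechet_derivative) (rule differentiable_christoffel)

lemma dchristoffel_linear2: "x \<in> U \<Longrightarrow> linear (\<lambda>v. d\<Gamma> x u v w)"
  using dir_deriv_linear_family[OF open_U _ christoffel_linear1 differentiable_christoffel] by blast

lemma dchristoffel_sym: "x \<in> U \<Longrightarrow> d\<Gamma> x u v w = d\<Gamma> x u w v"
  by (rule dir_deriv_cong_open[OF open_U]) (auto intro: christoffel_sym)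

lemma curvature_linear1:
  assumes x: "x \<in> U"
  shows "linear (\<lambda>u. R x u v w)"
proof (rule linearI)
  note l = dchristoffel_linear1[OF x] dchristoffel_linear2[OF x] christoffel_linear1[OF x] christoffel_linear2[OF x]
  show "R x (a + b) v w = R x a v w + R x b v w" for a b
    by (simp add: curvature_op_def l[THEN linear_add])
  show "R x (c *\<^sub>R a) v w = c *\<^sub>R R x a v w" for a c
    by (simp add: curvature_op_def l[THEN linear_cmul] algebra_simps)
qed

lemma curvature_anti12: "R x u v w = - R x v u w"
  by (simp add: curvature_op_def)

text \<open>The connection is torsion free: by symmetry of \<open>\<Gamma>\<close>, and hence of its
  derivatives, the terms cancel in pairs.\<close>

lemma bianchi:
  assumes x: "x \<in> U"
  shows "R x u v w + R x v w u + R x w u v = 0"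
  unfolding curvature_op_def
  using dchristoffel_sym[OF x, of v w u] dchristoffel_sym[OF x, of w u v] dchristoffel_sym[OF x, of u v w]
    christoffel_sym[OF x, of v w] christoffel_sym[OF x, of w u] christoffel_sym[OF x, of u v]
  by simp

lemma has_derivative_christoffel:
  "x \<in> U \<Longrightarrow> ((\<lambda>y. \<Gamma> y v w) has_derivative (\<lambda>u. d\<Gamma> x u v w)) (at x)"
  using differentiable_christoffel frechet_derivative_works by blast

text \<open>Metric compatibility differentiated once more. The part antisymmetric in
  \<open>u\<close> and \<open>v\<close> is expressed by the curvature.\<close>

lemma second_derivative_metric:
  assumes x: "x \<in> U"
  shows "dir_deriv (\<lambda>y. dh y v z w) x u =
    h x (\<Gamma> x u (\<Gamma> x v z)) w + h x (\<Gamma> x v z) (\<Gamma> x u w) + h x (d\<Gamma> x u v z) w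
    + (h x (\<Gamma> x u (\<Gamma> x v w)) z + h x (\<Gamma> x v w) (\<Gamma> x u z) + h x (d\<Gamma> x u v w) z)"
proof -
  have D: "((\<lambda>y. h y (\<Gamma> y v a) b) has_derivative
      (\<lambda>u. dh x u (\<Gamma> x v a) b + h x (d\<Gamma> x u v a) b)) (at x)" for a b
    by (rule has_derivative_linear_family[where B = "\<lambda>y a. h y a b", OF open_U x linear_left
          differentiable_h[OF x] has_derivative_ident has_derivative_christoffel[OF x]])
  have "dir_deriv (\<lambda>y. dh y v z w) x u = dir_deriv (\<lambda>y. h y (\<Gamma> y v z) w + h y (\<Gamma> y v w) z) x u"
    by (rule dir_deriv_cong_open[OF open_U x]) (simp add: metric_compatible h_sym)
  also have "\<dots> = (dh x u (\<Gamma> x v z) w + h x (d\<Gamma> x u v z) w) + (dh x u (\<Gamma> x v w) z + h x (d\<Gamma> x u v w) z)"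
    by (rule dir_deriv_eq[OF has_derivative_add[OF D D]])
  finally show ?thesis by (simp add: metric_compatible[OF x])
qed

text \<open>The derivatives of \<open>h y z w\<close> along \<open>u\<close> and \<open>v\<close>
  commute, and their commutator is \<open>h x (R x u v z) w + h x (R x u v w) z\<close>.\<close>

lemma curvature_anti34:
  assumes x: "x \<in> U"
  shows "h x (R x u v z) w = - h x (R x u v w) z"
proof -
  have "dir_deriv (\<lambda>y. dh y v z w) x u = dir_deriv (\<lambda>y. dh y u z w) x v"
    by (rule dir_deriv_commute[OF open_U x]) (auto intro: differentiable_h differentiable_dh[OF x])
  then show ?thesis
    unfolding second_derivative_metric[OF x] curvature_op_def
    using h_sym[OF x, of "\<Gamma> x v z" "\<Gamma> x u w"] h_sym[OF x, of "\<Gamma> x u z" "\<Gamma> x v w"]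
    by (simp add: linear_add[OF linear_left[OF x]] linear_diff[OF linear_left[OF x]])
qed

lemma curvature_pair_sym:
  assumes x: "x \<in> U"
  shows "h x (R x a b c) d = h x (R x c d a) b"
proof (rule curvature_pair_symmetry[where T = "\<lambda>a b c d. h x (R x a b c) d"])
  show "h x (R x a b c) d = - h x (R x b a c) d" for a b c d
    using linear_neg[OF linear_left[OF x]] curvature_anti12 by metis
  show "h x (R x a b c) d = - h x (R x a b d) c" for a b c d
    by (rule curvature_anti34[OF x])
  show "h x (R x a b c) d + h x (R x b c a) d + h x (R x c a b) d = 0" for a b c d
    using bianchi[OF x, of a b c] by (simp flip: linear_add[OF linear_left[OF x]] add: linear_0[OF linear_left[OF x]])
qed

end

section \<open>Kaehler domains\<close>

abbreviation J :: "complex^'m \<Rightarrow> complex^'m" where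
  "J v \<equiv> \<i> *s v"

lemma J_J [simp]: "J (J v) = - v"
  by (simp add: vector_smult_assoc vec_eq_iff)

lemma bounded_linear_J: "bounded_linear (J :: complex^'m::finite \<Rightarrow> _)"
proof -
  have "linear (J :: complex^'m \<Rightarrow> _)" by (rule linearI) (simp_all add: vec_eq_iff algebra_simps)
  then show ?thesis by (simp add: linear_conv_bounded_linear)
qed

lemmas linear_J = bounded_linear.linear[OF bounded_linear_J]

locale kaehler_domain = riemannian_domain U h
  for U :: "(complex^'m::finite) set" and h +
  assumes J_invariant: "x \<in> U \<Longrightarrow> h x (J u) (J v) = h x u v"
    and closed: "x \<in> U \<Longrightarrow>
      dir_deriv (\<lambda>y. h y (J v) w) x u - dir_deriv (\<lambda>y. h y (J u) w) x v
      + dir_deriv (\<lambda>y. h y (J u) v) x w = 0"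
begin

lemma J_skew: "x \<in> U \<Longrightarrow> h x (J u) v = - h x u (J v)"
  using J_invariant[of x u "J v"] linear_neg[OF linear_right, of x "J u" v] by simp

lemma dh_J_skew:
  assumes x: "x \<in> U"
  shows "dh x u (J v) w = - dh x u v (J w)"
proof -
  have "dh x u (J v) w = dir_deriv (\<lambda>y. - h y v (J w)) x u"
    by (rule dir_deriv_cong_open[OF open_U x]) (rule J_skew)
  also have "\<dots> = - dh x u v (J w)"
    by (rule dir_deriv_eq[OF has_derivative_minus[OF differentiable_h[OF x, unfolded frechet_derivative_works]]])
  finally show ?thesis .
qed

lemma dh_J_invariant: "x \<in> U \<Longrightarrow> dh x u (J v) (J w) = dh x u v w"
  using dh_J_skew[of x v "J w" u] linear_neg[OF dh_linear3, of x v w u] by simp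

text \<open>This is the parallelism of \<open>J\<close>. As \<open>J\<close> is constant in the
  coordinates, the Koszul formula expresses the difference of the two sides through closedness of
  the Kaehler form at \<open>(J v, J z, u)\<close> and \<open>(v, z, u)\<close>.\<close>

lemma christoffel_J:
  assumes x: "x \<in> U"
  shows "\<Gamma> x u (J v) = J (\<Gamma> x u v)"
proof (rule nondegenerate[OF x])
  fix z
  have "h x (J (\<Gamma> x u v)) z = - h x (\<Gamma> x u v) (J z)" by (rule J_skew[OF x])
  moreover have "dh x u (J (J v)) (J z) = - dh x u v (J z)"
    by (simp add: linear_neg[OF dh_linear2[OF x]])
  ultimately show "h x (\<Gamma> x u (J v)) z = h x (J (\<Gamma> x u v)) z"
    using koszul[OF x, of u "J v" z] koszul[OF x, of u v "J z"]
      closed[OF x, of "J v" "J z" u] closed[OF x, of v z u]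
      dh_J_invariant[OF x, of u z "J v"] dh_J_invariant[OF x, of u v "J z"]
      dh_J_skew[OF x, of v z u] dh_J_skew[OF x, of u z v] dh_J_skew[OF x, of u v z]
    by linarith
qed

lemma christoffel_J1: "x \<in> U \<Longrightarrow> \<Gamma> x (J u) v = J (\<Gamma> x u v)"
  by (metis christoffel_J christoffel_sym)

lemma dchristoffel_J:
  assumes x: "x \<in> U"
  shows "d\<Gamma> x u v (J w) = J (d\<Gamma> x u v w)"
proof -
  have "d\<Gamma> x u v (J w) = dir_deriv (\<lambda>y. J (\<Gamma> y v w)) x u"
    by (rule dir_deriv_cong_open[OF open_U x]) (rule christoffel_J)
  also have "\<dots> = J (d\<Gamma> x u v w)"
    by (rule dir_deriv_eq[OF bounded_linear.has_derivative[OF bounded_linear_J has_derivative_christoffel[OF x]]])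
  finally show ?thesis .
qed

lemma dchristoffel_J2: "x \<in> U \<Longrightarrow> d\<Gamma> x u (J v) w = J (d\<Gamma> x u v w)"
  by (metis dchristoffel_J dchristoffel_sym)

lemma curvature_J: "x \<in> U \<Longrightarrow> R x u v (J w) = J (R x u v w)"
  by (simp add: curvature_op_def dchristoffel_J christoffel_J linear_add[OF linear_J] linear_diff[OF linear_J])

text \<open>Pair symmetry moves both \<open>J\<close> to the last two arguments, where parallelism
  and invariance of the metric remove them.\<close>

lemma curvature_J_J:
  assumes x: "x \<in> U"
  shows "h x (R x (J a) (J b) c) d = h x (R x a b c) d"
  using curvature_pair_sym[OF x, of "J a" "J b" c d] curvature_pair_sym[OF x, of a b c d]
  by (simp add: curvature_J[OF x] J_invariant[OF x])

text \<open>The Bianchi identity for \<open>e\<close>, \<open>J e\<close>, \<open>J v\<close> splits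
  the right-hand side into two terms, which the symmetries under \<open>J\<close> identify with
  those on the left.\<close>

lemma curvature_J_plane:
  assumes x: "x \<in> U"
  shows "h x (R x e v v) e + h x (R x (J e) v v) (J e) = h x (R x (J e) e v) (J v)"
proof -
  note neg = linear_neg[OF linear_left[OF x]] linear_neg[OF curvature_linear1[OF x]]
  have a12: "h x (R x a b c) d = - h x (R x b a c) d" for a b c d
    using neg(1) curvature_anti12 by metis
  have "h x (R x (J e) v v) (J e) = - h x (R x (J e) v (J v)) e"
    using J_skew[OF x, of "R x (J e) v v" e] by (simp add: curvature_J[OF x])
  moreover have "h x (R x (J e) v (J v)) e = - h x (R x e (J v) (J v)) e"
    using curvature_J_J[OF x, of "J e" v "J v" e] by (simp add: neg)
  moreover have "h x (R x (J e) e v) (J v) = h x (R x e (J e) (J v)) v"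
    using a12[of "J e" e v "J v"] curvature_anti34[OF x, of e "J e" v "J v"] by simp
  moreover have "h x (R x e (J e) (J v)) v + h x (R x (J e) (J v) e) v + h x (R x (J v) e (J e)) v = 0"
    using bianchi[OF x, of e "J e" "J v"]
    by (simp flip: linear_add[OF linear_left[OF x]] add: linear_0[OF linear_left[OF x]])
  moreover have "h x (R x (J e) (J v) e) v = - h x (R x e v v) e"
    using curvature_J_J[OF x] curvature_anti34[OF x] by metis
  moreover have "h x (R x (J v) e (J e)) v = - h x (R x e (J v) (J v)) e"
    using J_skew[OF x, of "R x (J v) e e" v] a12[of "J v" e e "J v"] curvature_anti34[OF x, of e "J v" e "J v"]
    by (simp add: curvature_J[OF x])
  ultimately show ?thesis by linarith
qed

lemma orth_ricci_nonneg:
  assumes x: "x \<in> U" and V: "V \<noteq> 0"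
    and B: "\<And>e. 0 \<le> h x (R x (J e) e V) (J V)"
  shows "0 \<le> (\<Sum>b\<in>Basis. R x b V V \<bullet> b) - 1 / h x V V * h x (R x V (J V) (J V)) V"
proof -
  interpret F: inner_form "h x" by (rule form[OF x])
  note lin = linear_cmul[OF linear_left[OF x]] linear_cmul[OF linear_right[OF x]]
    linear_cmul[OF curvature_linear1[OF x]] linear_neg[OF linear_left[OF x]]
    linear_neg[OF linear_right[OF x]] linear_neg[OF curvature_linear1[OF x]]
  define n where "n = h x V V"
  have n: "n > 0" using F.pos[OF V] by (simp add: n_def)
  \<comment> \<open>\<open>e1\<close> and \<open>J e1\<close> start the orthonormal basis, so that
    the holomorphic sectional curvature of \<open>V\<close> appears among the summands.\<close>
  define e1 where "e1 = (1 / sqrt n) *\<^sub>R V"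
  have e11: "h x e1 e1 = 1" using n by (simp add: e1_def lin flip: n_def)
  have e12: "h x e1 (J e1) = 0" using J_skew[OF x, of e1 e1] h_sym[OF x, of e1 "J e1"] by simp
  have "F.orthonormal {e1, J e1}"
    using e11 e12 J_invariant[OF x, of e1 e1] h_sym[OF x, of e1 "J e1"] by (auto simp: F.orthonormal_def)
  then obtain S where S: "finite S" "{e1, J e1} \<subseteq> S" "\<And>w. (\<Sum>e\<in>S. h x w e *\<^sub>R e) = w"
    using F.orthonormal_basis_extending[of "{e1, J e1}"] by auto
  define t where "t e = h x (R x e V V) e" for e
  define B' where "B' e = h x (R x (J e) e V) (J V)" for e
  have tB: "t e + t (J e) = B' e" for e
    unfolding t_def B'_def by (rule curvature_J_plane[OF x])
  have tr1: "(\<Sum>b\<in>Basis. R x b V V \<bullet> b) = (\<Sum>e\<in>S. t e)"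
    unfolding t_def by (rule F.trace_orthonormal[OF S(1,3) curvature_linear1[OF x]])
  have inj: "inj_on J S"
    by (rule inj_onI) (metis J_J minus_equation_iff)
  \<comment> \<open>The image of \<open>S\<close> under \<open>J\<close> also has the expansion
    formula, so the trace can be taken over it too. Adding both traces pairs \<open>t e\<close> with
    \<open>t (J e)\<close>, although \<open>S\<close> itself need not be invariant under
    \<open>J\<close>.\<close>
  have rep: "(\<Sum>e\<in>J ` S. h x w e *\<^sub>R e) = w" for w
  proof -
    have "(\<Sum>e\<in>J ` S. h x w e *\<^sub>R e) = (\<Sum>e\<in>S. J (h x (- J w) e *\<^sub>R e))"
      unfolding sum.reindex[OF inj] o_def
      using J_skew[OF x] linear_neg[OF linear_left[OF x]] by (simp add: linear_cmul[OF linear_J])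
    also have "\<dots> = J (- J w)" by (subst S(3)[symmetric]) (simp add: linear_sum[OF linear_J])
    finally show ?thesis by (simp add: linear_neg[OF linear_J])
  qed
  have "(\<Sum>b\<in>Basis. R x b V V \<bullet> b) = (\<Sum>e\<in>J ` S. t e)"
    unfolding t_def using S(1) by (intro F.trace_orthonormal rep curvature_linear1[OF x]) auto
  also have "\<dots> = (\<Sum>e\<in>S. t (J e))" by (simp add: sum.reindex[OF inj])
  finally have "2 * (\<Sum>b\<in>Basis. R x b V V \<bullet> b) = (\<Sum>e\<in>S. B' e)"
    using tr1 by (simp add: tB[symmetric] sum.distrib)
  \<comment> \<open>By \<open>tB\<close> these two terms sum to
    \<open>t e1 + 2 * t (J e1) + t (J (J e1))\<close>. The outer summands are 0, and
    \<open>t (J e1)\<close> is the term subtracted in the orthogonal Ricci curvature.\<close>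
  moreover have "(\<Sum>e\<in>{e1, J e1}. B' e) \<le> (\<Sum>e\<in>S. B' e)"
    using S B by (intro sum_mono2) (auto simp: B'_def)
  moreover have "e1 \<noteq> J e1" using e11 e12 by force
  moreover have RVV: "R x V V V = 0" by (simp add: curvature_op_def)
  moreover have "t e1 = 0"
    by (simp add: t_def e1_def lin RVV linear_0[OF linear_left[OF x]])
  moreover have "t (J (J e1)) = t e1" by (simp add: t_def lin)
  moreover have "t (J e1) = h x (R x (J V) V V) (J V) / n"
    using n by (simp add: t_def e1_def linear_cmul[OF linear_J] lin)
  moreover have "h x (R x (J V) V V) (J V) = h x (R x V (J V) (J V)) V"
    using curvature_anti34[OF x, of "J V" V V "J V"] curvature_anti12[of x "J V" V "J V"] by (simp add: lin)
  ultimately show ?thesis using tB[of e1] tB[of "J e1"] by (simp add: n_def)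
qed

end

section \<open>The Bochner inequality at a maximum\<close>

text \<open>If \<open>D\<close> were positive, \<open>\<psi>\<close>, which vanishes at 0, would be
  positive just to the right of 0, and \<open>\<phi>\<close> would exceed \<open>\<phi> 0\<close>
  there.\<close>

lemma second_derivative_le_0_at_max:
  fixes \<phi> \<psi> :: "real \<Rightarrow> real"
  assumes \<delta>: "\<delta> > 0"
    and \<phi>: "\<And>r. \<bar>r\<bar> < \<delta> \<Longrightarrow> (\<phi> has_real_derivative \<psi> r) (at r)"
    and \<psi>: "(\<psi> has_real_derivative D) (at 0)"
    and max: "\<And>r. \<bar>r\<bar> < \<delta> \<Longrightarrow> \<phi> r \<le> \<phi> 0"
  shows "D \<le> 0"
proof (rule ccontr)
  assume "\<not> D \<le> 0"
  then obtain d where d: "d > 0" "\<And>r. 0 < r \<Longrightarrow> r < d \<Longrightarrow> \<psi> 0 < \<psi> r"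
    using DERIV_pos_inc_right[OF \<psi>] by force
  have \<psi>0: "\<psi> 0 = 0"
    using DERIV_local_max[OF \<phi>[of 0] \<delta>] max \<delta> by simp
  define r where "r = min d \<delta> / 2"
  have r: "0 < r" "r < d" "r < \<delta>" using d \<delta> by (auto simp: r_def min_def)
  have "\<exists>z. 0 < z \<and> z < r \<and> \<phi> r - \<phi> 0 = (r - 0) * \<psi> z"
    using r by (intro MVT2 \<phi>) auto
  then obtain z where z: "0 < z" "z < r" "\<phi> r - \<phi> 0 = r * \<psi> z" by auto
  then have "\<phi> r - \<phi> 0 > 0" using d(2)[of z] \<psi>0 r by simp
  then show False using max[of r] r by simp
qed

section \<open>Holomorphic maps along complex lines\<close>

lemma bounded_linear_smult_left: "bounded_linear (\<lambda>s. s *s (v :: complex^'m::finite))"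
proof -
  have "linear (\<lambda>s. s *s v)"
    by (rule linearI) (simp_all add: vec_eq_iff algebra_simps)
  then show ?thesis by (simp add: linear_conv_bounded_linear)
qed

lemma has_derivative_complex_line:
  "((\<lambda>t. x + t *s (v :: complex^'m::finite)) has_derivative (\<lambda>s. s *s v)) (at t)"
  by (auto intro!: derivative_eq_intros bounded_linear.has_derivative[OF bounded_linear_smult_left])

text \<open>Translates between the vector-valued derivatives of the geometry and the scalar
  functions to which Cauchy's theorem applies.\<close>

lemma has_derivative_componentwise_field:
  fixes W :: "complex \<Rightarrow> complex^'m::finite"
  shows "(W has_derivative (\<lambda>s. s *s w)) (at t) \<longleftrightarrow>
    (\<forall>i. ((\<lambda>t. W t $ i) has_field_derivative w $ i) (at t))"
proof
  assume W: "(W has_derivative (\<lambda>s. s *s w)) (at t)"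
  show "\<forall>i. ((\<lambda>t. W t $ i) has_field_derivative w $ i) (at t)"
    using bounded_linear.has_derivative[OF bounded_linear_vec_nth W]
    by (simp add: has_field_derivative_def mult.commute[of _ "w $ _"] mult_commute_abs)
next
  assume "\<forall>i. ((\<lambda>t. W t $ i) has_field_derivative w $ i) (at t)"
  then have "((\<lambda>t. W t $ i *s axis i 1) has_derivative (\<lambda>s. (w $ i * s) *s (axis i 1 :: complex^'m))) (at t)" for i
    by (intro bounded_linear.has_derivative[OF bounded_linear_smult_left]) (auto simp: has_field_derivative_def)
  then have "((\<lambda>t. \<Sum>i\<in>UNIV. W t $ i *s axis i 1) has_derivative
      (\<lambda>s. \<Sum>i\<in>UNIV. (s *s w) $ i *s (axis i 1 :: complex^'m))) (at t)"
    by (intro has_derivative_sum) (simp add: mult.commute)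
  then show "(W has_derivative (\<lambda>s. s *s w)) (at t)"
    by (simp only: basis_expansion)
qed

text \<open>On the line each component of \<open>V\<close> is a holomorphic function of one
  variable, so its derivative is again holomorphic. \<open>W1\<close> and \<open>W2\<close> collect
  the first and second complex derivatives.\<close>

lemma holomorphic_along_line:
  fixes V :: "complex^'m::finite \<Rightarrow> complex^'m"
  assumes U: "open U" and V: "holomorphic_map_on V U"
  obtains W1 W2 where
    "\<And>t. x + t *s v \<in> U \<Longrightarrow> ((\<lambda>t. V (x + t *s v)) has_derivative (\<lambda>s. s *s W1 t)) (at t)"
    "\<And>t. x + t *s v \<in> U \<Longrightarrow> (W1 has_derivative (\<lambda>s. s *s W2 t)) (at t)"
proof -
  define T where "T = (\<lambda>t. x + t *s v) -` U"
  have "continuous_on UNIV (\<lambda>t. x + t *s v)"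
    by (intro continuous_at_imp_continuous_on ballI has_derivative_continuous[OF has_derivative_complex_line])
  then have T: "open T" unfolding T_def by (rule open_vimage[OF U])
  define W where "W i t = V (x + t *s v) $ i" for i t
  have "\<exists>w. \<forall>i. (W i has_field_derivative w $ i) (at t)" if "t \<in> T" for t
  proof -
    have "x + t *s v \<in> U" using that by (simp add: T_def)
    from V[unfolded holomorphic_map_on_def, rule_format, OF this]
    obtain f' where f': "(V has_derivative f') (at (x + t *s v))" "\<forall>a u. f' (a *s u) = a *s f' u"
      by (elim exE conjE)
    have "((\<lambda>t. V (x + t *s v)) has_derivative (\<lambda>s. s *s f' v)) (at t)"
      using has_derivative_compose[OF has_derivative_complex_line f'(1)] by (simp add: f'(2))
    then show ?thesis unfolding has_derivative_componentwise_field W_def[abs_def] by (rule exI)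
  qed
  then have hol: "W i holomorphic_on T" for i
    by (subst holomorphic_on_open[OF T]) blast
  have hol': "deriv (W i) holomorphic_on T" for i
    by (rule holomorphic_deriv[OF hol T])
  define W1 where "W1 t = (\<chi> i. deriv (W i) t)" for t
  define W2 where "W2 t = (\<chi> i. deriv (deriv (W i)) t)" for t
  show thesis
  proof (rule that)
    fix t assume "x + t *s v \<in> U"
    then have t: "t \<in> T" by (simp add: T_def)
    show "((\<lambda>t. V (x + t *s v)) has_derivative (\<lambda>s. s *s W1 t)) (at t)"
      unfolding has_derivative_componentwise_field W1_def
      using holomorphic_derivI[OF hol T t] by (simp add: W_def[abs_def])
    show "(W1 has_derivative (\<lambda>s. s *s W2 t)) (at t)"
      unfolding has_derivative_componentwise_field W1_def W2_def
      using holomorphic_derivI[OF hol' T t] by simp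
  qed
qed

section \<open>Covariant product rule for the metric\<close>

context riemannian_domain
begin

lemma has_derivative_metric:
  assumes y: "(y has_derivative y') (at t)" and yt: "y t \<in> U"
    and a: "(a has_derivative a') (at t)" and b: "(b has_derivative b') (at t)"
  shows "((\<lambda>s. h (y s) (a s) (b s)) has_derivative
    (\<lambda>s. h (y t) (a' s + \<Gamma> (y t) (y' s) (a t)) (b t) + h (y t) (a t) (b' s + \<Gamma> (y t) (y' s) (b t)))) (at t)"
proof -
  \<comment> \<open>First the base point and one vector vary with \<open>w\<close> fixed. The pair
    of them then serves as the base point of a second linear family, over
    \<open>U \<times> UNIV\<close>.\<close>
  have D: "((\<lambda>q. h (fst q) (snd q) w) has_derivative
      (\<lambda>q. dh (y t) (fst q) (a t) w + h (y t) (snd q) w)) (at (y t, a t))" for w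
    using has_derivative_linear_family[where B = "\<lambda>y a. h y a w" and t = "(y t, a t)", OF open_U _ linear_left
        differentiable_h has_derivative_fst[OF has_derivative_ident] has_derivative_snd[OF has_derivative_ident]] yt
    by simp
  have "((\<lambda>s. h (fst (y s, a s)) (snd (y s, a s)) (b s)) has_derivative
      (\<lambda>s. dir_deriv (\<lambda>q. h (fst q) (snd q) (b t)) (y t, a t) (y' s, a' s)
        + h (fst (y t, a t)) (snd (y t, a t)) (b' s))) (at t)"
    using yt D by (intro has_derivative_linear_family[where B = "\<lambda>q. h (fst q) (snd q)" and U = "U \<times> UNIV"]
        open_Times open_U open_UNIV has_derivative_Pair y a b)
      (auto intro: linear_right simp: differentiable_def)
  moreover have "dir_deriv (\<lambda>q. h (fst q) (snd q) (b t)) (y t, a t) (y' s, a' s)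
      = dh (y t) (y' s) (a t) (b t) + h (y t) (a' s) (b t)" for s
    using dir_deriv_eq[OF D] by simp
  ultimately show ?thesis
    by (simp add: metric_compatible[OF yt] linear_add[OF linear_left[OF yt]] linear_add[OF linear_right[OF yt]]
        algebra_simps)
qed

end

section \<open>Second variation of the squared norm at a maximum\<close>

context kaehler_domain
begin

lemma christoffel_smult1:
  assumes x: "x \<in> U"
  shows "\<Gamma> x (a *s u) v = a *s \<Gamma> x u v"
proof -
  have *: "a *s w = Re a *\<^sub>R w + Im a *\<^sub>R J w" for w :: "complex^'m"
    by (simp add: vec_eq_iff complex_eq_iff)
  show ?thesis
    unfolding *[of u] *[of "\<Gamma> x u v"]
    by (simp add: linear_add[OF christoffel_linear1[OF x]] linear_cmul[OF christoffel_linear1[OF x]]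
        christoffel_J1[OF x])
qed

lemma curvature_nonneg_at_maximum:
  assumes V: "holomorphic_map_on V U" and x: "x \<in> U"
    and max: "\<And>y. y \<in> U \<Longrightarrow> h y (V y) (V y) \<le> h x (V x) (V x)"
  shows "0 \<le> h x (R x (J v) v (V x)) (J (V x))"
proof -
  obtain W1 W2 where
    W1: "\<And>t. x + t *s v \<in> U \<Longrightarrow> ((\<lambda>t. V (x + t *s v)) has_derivative (\<lambda>s. s *s W1 t)) (at t)" and
    W2: "\<And>t. x + t *s v \<in> U \<Longrightarrow> (W1 has_derivative (\<lambda>s. s *s W2 t)) (at t)"
    using holomorphic_along_line[OF open_U V, of x v] by blast
  define c where "c t = x + t *s v" for t
  define W where "W t = V (c t)" for t
  \<comment> \<open>The covariant derivative of \<open>V\<close> in the direction \<open>v\<close>,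
    as a function on the complex line.\<close>
  define N where "N t = W1 t + \<Gamma> (c t) v (W t)" for t
  have c0: "c 0 = x" by (simp add: c_def)
  have dc: "(c has_derivative (\<lambda>s. s *s v)) (at t)" for t
    unfolding c_def by (rule has_derivative_complex_line)
  have dW: "(W has_derivative (\<lambda>s. s *s W1 t)) (at t)" if "c t \<in> U" for t
    using W1 that unfolding W_def c_def by blast
  \<comment> \<open>The derivative of \<open>N\<close> at 0. Only the \<open>d\<Gamma>\<close> term
    can fail to be complex linear in \<open>s\<close>, and this failure is the curvature.\<close>
  define N' where "N' s = s *s W2 0 + (d\<Gamma> x (s *s v) v (V x) + \<Gamma> x v (s *s W1 0))" for s
  have "((\<lambda>t. \<Gamma> (c t) v (W t)) has_derivative
      (\<lambda>s. d\<Gamma> (c 0) (s *s v) v (W 0) + \<Gamma> (c 0) v (s *s W1 0))) (at 0)"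
    by (rule has_derivative_linear_family[where B = "\<lambda>y. \<Gamma> y v", OF open_U _ christoffel_linear2
          differentiable_christoffel dc dW]) (auto simp: c0 x)
  moreover have "(W1 has_derivative (\<lambda>s. s *s W2 0)) (at 0)"
    by (rule W2) (simp add: x)
  ultimately have dN: "(N has_derivative N') (at 0)"
    unfolding N_def[abs_def] N'_def[abs_def] using has_derivative_add by (fastforce simp: c0 W_def)
  \<comment> \<open>Holomorphy of \<open>V\<close> and complex linearity of \<open>\<Gamma>\<close>
    in its first argument make the covariant derivative along the line complex linear in the
    direction.\<close>
  have covW: "s *s W1 t + \<Gamma> (c t) (s *s v) (W t) = s *s N t" if "c t \<in> U" for s t
    by (simp add: N_def christoffel_smult1[OF that] vector_add_ldistrib)
  have dF: "((\<lambda>t. h (c t) (W t) (W t)) has_derivative (\<lambda>s. 2 * h (c t) (s *s N t) (W t))) (at t)"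
    if t: "c t \<in> U" for t
    using has_derivative_metric[OF dc t dW[OF t] dW[OF t]]
    by (simp add: covW[OF t] h_sym[OF t, of "W t"])
  \<comment> \<open>Half the second derivative of the squared norm at \<open>x\<close> along the
    real line in the direction \<open>d *s v\<close>. The values \<open>d = 1\<close> and
    \<open>d = \<i>\<close> give the directions \<open>v\<close> and \<open>J v\<close>.\<close>
  have D2: "h x (d *s N' d + \<Gamma> x (d *s v) (d *s N 0)) (V x) + h x (d *s N 0) (d *s N 0) \<le> 0" for d
  proof -
    define l where "l r = complex_of_real r * d" for r
    have dl: "(l has_derivative (\<lambda>k. complex_of_real k * d)) (at r)" for r
      unfolding l_def by (auto intro!: derivative_eq_intros)
    have smult_l: "(complex_of_real k * d) *s w = k *\<^sub>R (d *s w)" for k :: real and w :: "complex^'m"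
      unfolding vec_eq_iff vector_scaleR_component vector_smult_component by (simp add: scaleR_conv_of_real)
    have "open ((\<lambda>r. c (l r)) -` U)"
    proof (rule open_vimage[OF open_U])
      show "continuous_on UNIV (\<lambda>r. c (l r))"
        by (intro continuous_at_imp_continuous_on ballI
            has_derivative_continuous[OF has_derivative_compose[OF dl dc]])
    qed
    then obtain \<delta> where \<delta>: "\<delta> > 0" "ball 0 \<delta> \<subseteq> (\<lambda>r. c (l r)) -` U"
      using x by (metis (mono_tags, lifting) c0 l_def mult_zero_left of_real_0 open_contains_ball vimageI)
    then have cl: "c (l r) \<in> U" if "\<bar>r\<bar> < \<delta>" for r using that by (auto simp: subset_iff)
    define \<phi> where "\<phi> r = h (c (l r)) (W (l r)) (W (l r))" for r
    define \<psi> where "\<psi> r = 2 * h (c (l r)) (d *s N (l r)) (W (l r))" for r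
    have d\<phi>: "(\<phi> has_real_derivative \<psi> r) (at r)" if r: "\<bar>r\<bar> < \<delta>" for r
    proof -
      have "(\<phi> has_derivative (\<lambda>k. 2 * h (c (l r)) ((complex_of_real k * d) *s N (l r)) (W (l r)))) (at r)"
        unfolding \<phi>_def by (rule has_derivative_compose[OF dl dF[OF cl[OF r]]])
      moreover have "(\<lambda>k. 2 * h (c (l r)) ((complex_of_real k * d) *s N (l r)) (W (l r))) = (*) (\<psi> r)"
        by (simp add: fun_eq_iff smult_l linear_cmul[OF linear_left[OF cl[OF r]]] \<psi>_def)
      ultimately show ?thesis by (simp add: has_field_derivative_def)
    qed
    have l0: "l 0 = 0" by (simp add: l_def)
    have dcl: "((\<lambda>r. c (l r)) has_derivative (\<lambda>k. k *\<^sub>R (d *s v))) (at 0)"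
      using has_derivative_compose[OF dl dc, of 0] by (simp add: smult_l)
    have dWl: "((\<lambda>r. W (l r)) has_derivative (\<lambda>k. k *\<^sub>R (d *s W1 0))) (at 0)"
      using has_derivative_compose[OF dl, of W "\<lambda>s. s *s W1 0" 0] dW[of 0] by (simp add: smult_l l0 c0 x)
    have N'lin: "linear N'" using dN has_derivative_linear by blast
    have dNl: "((\<lambda>r. d *s N (l r)) has_derivative (\<lambda>k. k *\<^sub>R (d *s N' d))) (at 0)"
    proof -
      have "((\<lambda>r. N (l r)) has_derivative (\<lambda>k. k *\<^sub>R N' d)) (at 0)"
        using has_derivative_compose[OF dl, of N N' 0] dN linear_cmul[OF N'lin, of _ d]
        by (simp add: l0 flip: scaleR_conv_of_real)
      moreover have "bounded_linear (\<lambda>w :: complex^'m. d *s w)"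
        unfolding linear_conv_bounded_linear[symmetric]
        by (rule linearI) (simp_all add: vec_eq_iff algebra_simps)
      ultimately have "((\<lambda>r. d *s N (l r)) has_derivative (\<lambda>k. d *s (k *\<^sub>R N' d))) (at 0)"
        using bounded_linear.has_derivative by blast
      moreover have "d *s (k *\<^sub>R w) = k *\<^sub>R (d *s w)" for k :: real and w :: "complex^'m" by (simp add: vec_eq_iff)
      ultimately show ?thesis by simp
    qed
    let ?D = "2 * (h x (d *s N' d + \<Gamma> x (d *s v) (d *s N 0)) (V x) + h x (d *s N 0) (d *s N 0))"
    have "(\<psi> has_derivative (\<lambda>k. 2 * (h x (k *\<^sub>R (d *s N' d) + \<Gamma> x (k *\<^sub>R (d *s v)) (d *s N 0)) (V x)
        + h x (d *s N 0) (k *\<^sub>R (d *s W1 0) + \<Gamma> x (k *\<^sub>R (d *s v)) (V x))))) (at 0)"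
      unfolding \<psi>_def
      using has_derivative_metric[OF dcl _ dNl dWl] by (intro has_derivative_mult_right) (simp add: l0 c0 x W_def)
    moreover have "2 * (h x (k *\<^sub>R (d *s N' d) + \<Gamma> x (k *\<^sub>R (d *s v)) (d *s N 0)) (V x)
        + h x (d *s N 0) (k *\<^sub>R (d *s W1 0) + \<Gamma> x (k *\<^sub>R (d *s v)) (V x))) = ?D * k" for k
    proof -
      \<comment> \<open>The derivative of \<open>V\<close> itself along the real line is again
        \<open>d *s N 0\<close>, which produces the squared norm in \<open>?D\<close>.\<close>
      have e: "k *\<^sub>R (d *s W1 0) + \<Gamma> x (k *\<^sub>R (d *s v)) (V x) = k *\<^sub>R (d *s N 0)"
        using covW[of 0 d] x by (simp add: c0 W_def linear_cmul[OF christoffel_linear1[OF x]] flip: scaleR_add_right)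
      have e': "h x (k *\<^sub>R (d *s N' d) + \<Gamma> x (k *\<^sub>R (d *s v)) (d *s N 0)) (V x)
          = k * h x (d *s N' d + \<Gamma> x (d *s v) (d *s N 0)) (V x)"
        by (simp add: linear_cmul[OF christoffel_linear1[OF x]] linear_cmul[OF linear_left[OF x]] flip: scaleR_add_right)
      show ?thesis
        unfolding e e' linear_cmul[OF linear_right[OF x]] by (simp add: algebra_simps)
    qed
    ultimately have d\<psi>: "(\<psi> has_real_derivative ?D) (at 0)"
      by (simp add: has_field_derivative_def)
    have "\<phi> r \<le> \<phi> 0" if "\<bar>r\<bar> < \<delta>" for r
      using max[OF cl[OF that]] by (simp add: \<phi>_def W_def l0 c0)
    from second_derivative_le_0_at_max[OF \<delta>(1) d\<phi> d\<psi> this] show ?thesis by simp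
  qed
  note Jlin = linear_add[OF linear_J] linear_diff[OF linear_J]
  note left_add = linear_add[OF linear_left[OF x]]
  \<comment> \<open>Complex linear terms of \<open>N'\<close> cancel between \<open>N' 1\<close> and
    \<open>J (N' \<i>)\<close> because \<open>J\<close> squares to -1; so do the terms in
    \<open>N 0\<close>, and on the right the quadratic terms in \<open>\<Gamma>\<close>. Derivatives
    of \<open>\<Gamma>\<close> remain on both sides.\<close>
  have "N' 1 + \<Gamma> x v (N 0) + (J (N' \<i>) + \<Gamma> x (J v) (J (N 0))) = J (R x (J v) v (V x))"
    by (simp add: N'_def curvature_op_def Jlin christoffel_J[OF x] christoffel_J1[OF x] dchristoffel_J2[OF x])
  then have "h x (J (R x (J v) v (V x))) (V x) =
      h x (N' 1 + \<Gamma> x v (N 0)) (V x) + h x (J (N' \<i>) + \<Gamma> x (J v) (J (N 0))) (V x)"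
    by (metis left_add)
  moreover have "h x (N 0) (N 0) \<ge> 0"
    using inner_form.pos[OF form[OF x], of "N 0"] linear_0[OF linear_left[OF x]] by (cases "N 0 = 0") auto
  moreover have "h x (J (N 0)) (J (N 0)) = h x (N 0) (N 0)" by (rule J_invariant[OF x])
  ultimately have "h x (J (R x (J v) v (V x))) (V x) \<le> 0"
    using D2[of 1] D2[of \<i>] by simp
  then show ?thesis using J_skew[OF x] by simp
qed

end

section \<open>Vector fields on a complex manifold\<close>

locale complex_atlas =
  fixes M :: "'a topology" and A :: "('a, 'm::finite) chart set"
  assumes manifold: "complex_manifold M A"
begin

lemma openin_chart_dom: "c \<in> A \<Longrightarrow> openin M (chart_dom c)"
  and open_chart_image: "c \<in> A \<Longrightarrow> open (chart_image c)"
  and chart_homeomorphic: "c \<in> A \<Longrightarrow>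
    homeomorphic_map (subtopology M (chart_dom c)) (top_of_set (chart_image c)) (chart_map c)"
  and holomorphic_transition: "c \<in> A \<Longrightarrow> d \<in> A \<Longrightarrow>
    holomorphic_map_on (transition c d) (chart_map c ` (chart_dom c \<inter> chart_dom d))"
  and chart_cover: "(\<Union>c\<in>A. chart_dom c) = topspace M"
  using manifold by (simp_all add: complex_manifold_def)

lemma chart_dom_subset: "c \<in> A \<Longrightarrow> chart_dom c \<subseteq> topspace M"
  using openin_chart_dom openin_subset by blast

lemma chart_inj: "c \<in> A \<Longrightarrow> inj_on (chart_map c) (chart_dom c)"
  using homeomorphic_imp_injective_map[OF chart_homeomorphic[of c]] chart_dom_subset[of c]
  by (simp add: topspace_subtopology Int_absorb1)

lemma chart_inv_chart_map: "c \<in> A \<Longrightarrow> p \<in> chart_dom c \<Longrightarrow> chart_inv c (chart_map c p) = p"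
  using chart_inj inv_into_f_f by fast

lemma chart_inv_in_dom: "x \<in> chart_image c \<Longrightarrow> chart_inv c x \<in> chart_dom c"
  by (rule inv_into_into)

lemma open_chart_overlap:
  assumes "c \<in> A" "d \<in> A"
  shows "open (chart_map c ` (chart_dom c \<inter> chart_dom d))"
proof -
  have "openin (subtopology M (chart_dom c)) (chart_dom c \<inter> chart_dom d)"
    using openin_chart_dom[OF assms(2)] openin_subtopology_Int2 by blast
  with homeomorphic_imp_open_map[OF chart_homeomorphic[OF assms(1)]]
  have "openin (top_of_set (chart_image c)) (chart_map c ` (chart_dom c \<inter> chart_dom d))"
    unfolding open_map_def by blast
  then show ?thesis using openin_open_eq[OF open_chart_image[OF assms(1)]] by blast
qed

lemma transition_derivative:
  assumes "c \<in> A" "d \<in> A" "p \<in> chart_dom c" "p \<in> chart_dom d"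
  shows "(transition c d has_derivative dir_deriv (transition c d) (chart_map c p)) (at (chart_map c p))"
    and "dir_deriv (transition c d) (chart_map c p) (a *s u) = a *s dir_deriv (transition c d) (chart_map c p) u"
proof -
  have "chart_map c p \<in> chart_map c ` (chart_dom c \<inter> chart_dom d)" using assms by blast
  from holomorphic_transition[OF assms(1,2), unfolded holomorphic_map_on_def, rule_format, OF this]
  obtain f' where f': "(transition c d has_derivative f') (at (chart_map c p))"
    "\<forall>a u. f' (a *s u) = a *s f' u"
    by (elim exE conjE)
  note eq = frechet_derivative_at[OF f'(1)]
  show "(transition c d has_derivative dir_deriv (transition c d) (chart_map c p)) (at (chart_map c p))"
    "dir_deriv (transition c d) (chart_map c p) (a *s u) = a *s dir_deriv (transition c d) (chart_map c p) u"
    using f' unfolding eq by auto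
qed

section \<open>Tangent vectors in coordinates\<close>

lemma tvec_of_coords_self:
  assumes c: "c \<in> A" and p: "p \<in> chart_dom c"
  shows "tvec_of_coords A c p u c = u"
proof -
  have "dir_deriv (transition c c) (chart_map c p) u = dir_deriv (\<lambda>x. x) (chart_map c p) u"
    using open_chart_image[OF c] p
    by (intro dir_deriv_cong_open[where U = "chart_image c"]) (auto simp: transition_def chart_inv_chart_map c)
  then show ?thesis using c p by (simp add: tvec_of_coords_def)
qed

text \<open>The transformation law is the chain rule for the cocycle identity: on the overlap of
  \<open>c\<close> and \<open>d\<close>, passing from \<open>c\<close> to \<open>e\<close> agrees
  with passing through \<open>d\<close>.\<close>

lemma tvec_of_coords_in_tangent_space:
  assumes c: "c \<in> A" and p: "p \<in> chart_dom c"
  shows "tvec_of_coords A c p u \<in> tangent_space A p"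
proof -
  have chain: "dir_deriv (transition c e) (chart_map c p) u
      = dir_deriv (transition d e) (chart_map d p) (dir_deriv (transition c d) (chart_map c p) u)"
    if d: "d \<in> A" "p \<in> chart_dom d" and e: "e \<in> A" "p \<in> chart_dom e" for d e
  proof -
    have tp: "transition c d (chart_map c p) = chart_map d p"
      by (simp add: transition_def chart_inv_chart_map c p)
    have "((\<lambda>x. transition d e (transition c d x)) has_derivative
        (\<lambda>u. dir_deriv (transition d e) (chart_map d p) (dir_deriv (transition c d) (chart_map c p) u)))
        (at (chart_map c p))"
      using has_derivative_compose[OF transition_derivative(1)[OF c d(1) p d(2)], of "transition d e"]
        transition_derivative(1)[OF d(1) e(1) d(2) e(2)] by (simp add: tp)
    from dir_deriv_eq[OF this]
    have "dir_deriv (\<lambda>x. transition d e (transition c d x)) (chart_map c p) u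
      = dir_deriv (transition d e) (chart_map d p) (dir_deriv (transition c d) (chart_map c p) u)" .
    moreover have "dir_deriv (transition c e) (chart_map c p) u
      = dir_deriv (\<lambda>x. transition d e (transition c d x)) (chart_map c p) u"
      using c d p
      by (intro dir_deriv_cong_open[OF open_chart_overlap[OF c d(1)]])
        (auto simp: transition_def chart_inv_chart_map)
    ultimately show ?thesis by simp
  qed
  show ?thesis
    unfolding tangent_space_def
  proof (intro CollectI conjI ballI allI impI)
    fix d e assume "d \<in> A" "e \<in> A" "p \<in> chart_dom d \<and> p \<in> chart_dom e"
    then show "tvec_of_coords A c p u e = dir_deriv (transition d e) (chart_map d p) (tvec_of_coords A c p u d)"
      using chain[of d e] by (simp add: tvec_of_coords_def)
  qed (auto simp: tvec_of_coords_def)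
qed

text \<open>Allows the metric to be evaluated in a single chart: the transformation law determines
  all other coordinates.\<close>

lemma tangent_vector_coords:
  assumes X: "X \<in> tangent_space A p" and c: "c \<in> A" "p \<in> chart_dom c"
  shows "tvec_of_coords A c p (X c) = X"
proof
  fix d
  show "tvec_of_coords A c p (X c) d = X d"
  proof (cases "d \<in> A \<and> p \<in> chart_dom d")
    case True
    then have "X d = dir_deriv (transition c d) (chart_map c p) (X c)"
      using X c unfolding tangent_space_def by blast
    then show ?thesis using True by (simp only: tvec_of_coords_def if_True simp_thms)
  next
    case False
    then have "X d = 0" using X unfolding tangent_space_def by blast
    then show ?thesis using False by (simp only: tvec_of_coords_def if_False)
  qed
qed

lemma tvec_of_coords_add:
  assumes c: "c \<in> A" and p: "p \<in> chart_dom c"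
  shows "tvec_of_coords A c p (u + v) = tvec_add (tvec_of_coords A c p u) (tvec_of_coords A c p v)"
  using linear_add[OF has_derivative_linear[OF transition_derivative(1)[OF c _ p]]]
  by (auto simp: tvec_of_coords_def tvec_add_def)

lemma tvec_of_coords_scaleR:
  assumes c: "c \<in> A" and p: "p \<in> chart_dom c"
  shows "tvec_of_coords A c p (a *\<^sub>R u) = tvec_scale a (tvec_of_coords A c p u)"
  using linear_cmul[OF has_derivative_linear[OF transition_derivative(1)[OF c _ p]]]
  by (auto simp: tvec_of_coords_def tvec_scale_def)

lemma tvec_of_coords_J:
  assumes c: "c \<in> A" and p: "p \<in> chart_dom c"
  shows "tvec_of_coords A c p (J u) = cpx_struct (tvec_of_coords A c p u)"
  using transition_derivative(2)[OF c _ p] by (auto simp: tvec_of_coords_def cpx_struct_def)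

section \<open>The metric in charts\<close>

lemma inner_form_local_metric:
  assumes g: "riemannian_metric M A g" and c: "c \<in> A" and x: "x \<in> chart_image c"
  shows "inner_form (local_metric A g c x)"
proof -
  let ?p = "chart_inv c x"
  have p: "?p \<in> chart_dom c" "?p \<in> topspace M"
    using chart_inv_in_dom[OF x] chart_dom_subset[OF c] by auto
  note mem = tvec_of_coords_in_tangent_space[OF c p(1)]
  have G: "g ?p (tvec_add X Y) Z = g ?p X Z + g ?p Y Z" "g ?p (tvec_scale a X) Z = a * g ?p X Z"
    "g ?p X Y = g ?p Y X" "X \<noteq> tvec_zero \<Longrightarrow> g ?p X X > 0"
    if "X \<in> tangent_space A ?p" "Y \<in> tangent_space A ?p" "Z \<in> tangent_space A ?p" for X Y Z a
    using g that p(2) unfolding riemannian_metric_def by blast+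
  show ?thesis
  proof (rule inner_form.intro)
    show "linear (\<lambda>u. local_metric A g c x u w)" for w
      using G(1,2)[OF mem mem mem]
      by (intro linearI) (simp_all add: local_metric_def tvec_of_coords_add[OF c p(1)] tvec_of_coords_scaleR[OF c p(1)])
    show "local_metric A g c x u v = local_metric A g c x v u" for u v
      using G(3)[OF mem mem mem] by (simp add: local_metric_def)
    show "0 < local_metric A g c x u u" if "u \<noteq> 0" for u
    proof -
      have "tvec_of_coords A c ?p u \<noteq> tvec_zero"
        using tvec_of_coords_self[OF c p(1), of u] that by (auto simp: tvec_zero_def)
      then show ?thesis using G(4)[OF mem mem mem] by (simp add: local_metric_def)
    qed
  qed
qed

lemma kaehler_domain_local_metric:
  assumes g: "kaehler_metric M A g" and c: "c \<in> A"
  shows "kaehler_domain (chart_image c) (local_metric A g c)"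
proof (intro kaehler_domain.intro riemannian_domain.intro kaehler_domain_axioms.intro)
  have r: "riemannian_metric M A g" using g by (simp add: kaehler_metric_def)
  fix x u v w
  show "open (chart_image c)" by (rule open_chart_image[OF c])
  show "smooth_on (chart_image c) (\<lambda>x. local_metric A g c x u v)"
    using r c by (simp add: riemannian_metric_def)
  assume x: "x \<in> chart_image c"
  show "inner_form (local_metric A g c x)" by (rule inner_form_local_metric[OF r c x])
  let ?p = "chart_inv c x"
  have p: "?p \<in> chart_dom c" "?p \<in> topspace M"
    using chart_inv_in_dom[OF x] chart_dom_subset[OF c] by auto
  show "local_metric A g c x (J u) (J v) = local_metric A g c x u v"
    using g p(2) tvec_of_coords_in_tangent_space[OF c p(1)]
    by (simp add: local_metric_def tvec_of_coords_J[OF c p(1)] kaehler_metric_def)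
  show "dir_deriv (\<lambda>y. local_metric A g c y (J v) w) x u - dir_deriv (\<lambda>y. local_metric A g c y (J u) w) x v
      + dir_deriv (\<lambda>y. local_metric A g c y (J u) v) x w = 0"
    using g c x unfolding kaehler_metric_def Let_def by blast
qed

lemma metric_in_chart:
  assumes "X \<in> tangent_space A p" "Y \<in> tangent_space A p" "c \<in> A" "p \<in> chart_dom c"
  shows "g p X Y = local_metric A g c (chart_map c p) (X c) (Y c)"
  using assms by (simp add: local_metric_def chart_inv_chart_map tangent_vector_coords)

text \<open>Continuity is local. In a chart, \<open>V\<close> is differentiable by holomorphy, so
  the covariant product rule makes the squared norm differentiable; the pasting lemma is applied to
  one and the same function on every chart domain.\<close>

lemma continuous_map_norm_sq:
  assumes g: "kaehler_metric M A g" and V: "holomorphic_vector_field M A V"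
  shows "continuous_map M euclideanreal (\<lambda>p. g p (V p) (V p))"
proof (rule pasting_lemma[where I = A and T = chart_dom and f = "\<lambda>_ p. g p (V p) (V p)"])
  fix c assume c: "c \<in> A"
  show "openin M (chart_dom c)" by (rule openin_chart_dom[OF c])
  interpret kaehler_domain "chart_image c" "local_metric A g c"
    by (rule kaehler_domain_local_metric[OF g c])
  define W where "W x = V (chart_inv c x) c" for x
  have "holomorphic_map_on W (chart_image c)"
    using V c unfolding holomorphic_vector_field_def W_def[abs_def] by blast
  then have "isCont (\<lambda>x. local_metric A g c x (W x) (W x)) x" if "x \<in> chart_image c" for x
    using that has_derivative_metric[OF has_derivative_ident] has_derivative_continuous
    unfolding holomorphic_map_on_def by meson
  then have "continuous_on (chart_image c) (\<lambda>x. local_metric A g c x (W x) (W x))"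
    by (simp add: continuous_at_imp_continuous_on)
  then have "continuous_map (subtopology M (chart_dom c)) euclideanreal
      ((\<lambda>x. local_metric A g c x (W x) (W x)) \<circ> chart_map c)"
    by (intro continuous_map_compose[OF homeomorphic_imp_continuous_map[OF chart_homeomorphic[OF c]]])
      simp
  then show "continuous_map (subtopology M (chart_dom c)) euclideanreal (\<lambda>p. g p (V p) (V p))"
  proof (rule continuous_map_eq)
    fix p assume "p \<in> topspace (subtopology M (chart_dom c))"
    then have p: "p \<in> chart_dom c" "p \<in> topspace M" by auto
    then have "V p \<in> tangent_space A p" using V by (simp add: holomorphic_vector_field_def)
    from metric_in_chart[OF this this c p(1)]
    show "((\<lambda>x. local_metric A g c x (W x) (W x)) \<circ> chart_map c) p = g p (V p) (V p)"
      by (simp add: W_def chart_inv_chart_map[OF c p(1)])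
  qed
next
  fix p assume "p \<in> topspace M"
  then show "\<exists>c. c \<in> A \<and> p \<in> chart_dom c \<and> g p (V p) (V p) = g p (V p) (V p)"
    using chart_cover by blast
qed simp

end

section \<open>The maximum of the squared norm and the contradiction\<close>

theorem proposition1p1:
  fixes M :: "'a topology"
    and A :: "('a, 'm::finite) chart set"
    and g :: "'a \<Rightarrow> ('a, 'm) tvec \<Rightarrow> ('a, 'm) tvec \<Rightarrow> real"
  assumes "complex_manifold M A"
    and "compact_space M"
    and "kaehler_metric M A g"
    and "orth_ricci_negative M A g"
  shows "\<not> (\<exists>V. holomorphic_vector_field M A V \<and> (\<exists>p\<in>topspace M. V p \<noteq> tvec_zero))"
proof (rule notI, elim exE conjE bexE)
  fix V q
  assume V: "holomorphic_vector_field M A V" and q: "q \<in> topspace M" "V q \<noteq> tvec_zero"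
  interpret complex_atlas M A by (rule complex_atlas.intro[OF assms(1)])
  have tangent: "V p \<in> tangent_space A p" if "p \<in> topspace M" for p
    using V that by (simp add: holomorphic_vector_field_def)
  define \<phi> where "\<phi> p = g p (V p) (V p)" for p
  have "compactin euclideanreal (\<phi> ` topspace M)"
    unfolding \<phi>_def using assms(2) continuous_map_norm_sq[OF assms(3) V]
    by (intro image_compactin[of M]) (auto simp: compact_space_def)
  then have "\<exists>s\<in>\<phi> ` topspace M. \<forall>t\<in>\<phi> ` topspace M. t \<le> s"
    using q(1) by (intro compact_attains_sup) auto
  then obtain p where p: "p \<in> topspace M" "\<And>r. r \<in> topspace M \<Longrightarrow> \<phi> r \<le> \<phi> p"
    by blast
  \<comment> \<open>Positivity at \<open>q\<close> passes to the maximum, so \<open>V\<close> does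
    not vanish at \<open>p\<close> and the curvature hypothesis can be applied to
    \<open>V p\<close>.\<close>
  have "\<phi> q > 0"
    using assms(3) tangent[OF q(1)] q by (simp add: \<phi>_def kaehler_metric_def riemannian_metric_def)
  then have pos: "\<phi> p > 0" using p(2)[OF q(1)] by simp
  obtain c where c: "c \<in> A" "p \<in> chart_dom c" using p(1) chart_cover by blast
  interpret kaehler_domain "chart_image c" "local_metric A g c"
    by (rule kaehler_domain_local_metric[OF assms(3) c(1)])
  define W where "W x = V (chart_inv c x) c" for x
  have \<phi>W: "local_metric A g c (chart_map c r) (W (chart_map c r)) (W (chart_map c r)) = \<phi> r"
    if r: "r \<in> chart_dom c" for r
  proof -
    have "V r \<in> tangent_space A r" using tangent r chart_dom_subset[OF c(1)] by blast
    from metric_in_chart[OF this this c(1) r] show ?thesis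
      by (simp add: \<phi>_def W_def chart_inv_chart_map[OF c(1) r])
  qed
  let ?x = "chart_map c p"
  have x: "?x \<in> chart_image c" using c(2) by blast
  have Wx: "W ?x = V p c" by (simp add: W_def chart_inv_chart_map c)
  have hol: "holomorphic_map_on W (chart_image c)"
    using V c(1) unfolding holomorphic_vector_field_def W_def[abs_def] by blast
  \<comment> \<open>The maximum over \<open>M\<close> restricts to the chart image, where the local
    argument takes place.\<close>
  have max: "local_metric A g c y (W y) (W y) \<le> local_metric A g c ?x (W ?x) (W ?x)" if "y \<in> chart_image c" for y
    using that \<phi>W c p(2) chart_dom_subset[OF c(1)] by auto
  have W0: "W ?x \<noteq> 0"
    using \<phi>W[OF c(2)] pos linear_0[OF linear_left[OF x]] by force
  from orth_ricci_nonneg[OF x W0 curvature_nonneg_at_maximum[OF hol x max]]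
  have "0 \<le> orth_ricci A g c p (V p)"
    using \<phi>W[OF c(2)]
    by (simp add: Wx orth_ricci_def ricci_curvature_def curvature_tensor_def cpx_struct_def \<phi>_def)
  moreover have "orth_ricci A g c p (V p) < 0"
  proof -
    have "V p \<noteq> tvec_zero" using W0 Wx by (auto simp: tvec_zero_def)
    then show ?thesis using assms(4) p(1) c tangent[OF p(1)] by (simp add: orth_ricci_negative_def)
  qed
  ultimately show False by simp
qed

end
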